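(* Let $Y=C[0,1]\times C[0,1]$ with norm $\|(u_1,u_2)\|_Y=\max(\|u_1\|_\infty,\|u_2\|_\infty)$, where $\|x\|_\infty=\sup_{t\in[0,1]}|x(t)|$. For $i=1,2$ assume: (D1) $F_i:[0,1]\times[0,+\infty)\times[0,+\infty)\to[0,+\infty)$ satisfies: $F_i(\cdot,u_1,u_2)$ is measurable for each fixed $u_1,u_2\ge 0$; $F_i(t,\cdot,\cdot)$ is continuous for a.e. $t\in[0,1]$; and for each $R>0$ there is $\psi_{iR}\in L^\infty[0,1]$ with $F_i(t,u_1,u_2)\le\psi_{iR}(t)$ for all $u_1,u_2\in(0,R)$ and a.e. $t\in[0,1]$. (D2) $K_i:[0,1]\times[0,1]\to[0,+\infty)$ is measurable and for every $\bar t\in[0,1]$, $\lim_{t\to\bar t}|K_i(t,s)-K_i(\bar t,s)|=0$. (D3) There exist subintervals $[a_i,b_i]\subseteq[0,1]$, functions $\Phi_i\in L^\infty[0,1]$ and constants $c_i\in(0,1]$ such that $K_i(t,s)\le\Phi_i(s)$ for $t\in[0,1]$ and a.e. $s\in[0,1]$, and $K_i(t,s)\ge c_i\Phi_i(s)$ for $t\in[a_i,b_i]$ and a.e. $s\in[0,1]$. (D4) $\psi_{ij}\in C([0,1],[0,+\infty))$ for $j=0,1$, and there exist $c_{ij}\in(0,1]$ with $\psi_{ij}(t)\ge c_{ij}\|\psi_{ij}\|_\infty$ for every $t\in[a_i,b_i]$. Let $\tilde c_i=\min\{c_i,c_{i0},c_{i1}\}$, let $Q_i=\{x\in C[0,1]: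 x(t)\ge0 \text{ for all } t\in[0,1],\ \min_{t\in[a_i,b_i]}x(t)\ge\tilde c_i\|x\|_\infty\}$, and let $Q=\{(u_1,u_2): u_1\in Q_1,\,u_2\in Q_2\}\subset Y$. For $R>0$ let $\partial Q_R=\{(u_1,u_2)\in Q:\|(u_1,u_2)\|_Y=R\}$. (D5) $H_i,G_i:Q\to[0,+\infty)$ are compact functionals. Define $S(u_1,u_2)=(S_1(u_1,u_2),S_2(u_1,u_2))$ on $Q$ by $$S_i(u_1,u_2)(t)=\psi_{i0}(t)H_i[u_1,u_2]+\psi_{i1}(t)G_i[u_1,u_2]+\int_0^1K_i(t,s)F_i(s,u_1(s),u_2(s))\,ds,\quad i=1,2.$$ Fix $R\in(0,+\infty)$ and suppose that for $i=1,2$: (1) there exists $\gamma_{iR}\in C([0,1],[0,+\infty))$ such that $F_i(t,u_1,u_2)\ge\gamma_{iR}(t)$ for all $t\in[a_i,b_i]$ and all $(u_1,u_2)$ with $u_k\in[\delta_{ik}\tilde c_iR,R]$ for $k=1,2$ (here $\delta_{ik}$ is the Kronecker delta; i.e. for $i=1$: $u_1\in[\tilde c_1R,R]$, $u_2\in[0,R]$; for $i=2$: $u_1\in[0,R]$, $u_2\in[\tilde c_2R,R]$); (2) there exist $\zeta^H_{iR},\zeta^G_{iR}\in[0,+\infty)$ such that $H_i[u_1,u_2]\ge\zeta^H_{iR}$ and $G_i[u_1,u_2]\ge\zeta^G_{iR}$ for every $(u_1,u_2)\in\partial Q_R$; (3) $\displaystyle\sup_{t\in[a_i,b_i]}\Big[\psi_{i0}(t)\zeta^H_{iR}+\psi_{i1}(t)\zeta^G_{iR}+\int_{a_i}^{b_i}K_i(t,s)\gamma_{iR}(s)\,ds\Big]>0.$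 Then there exist $\lambda_R\in(0,+\infty)$ and $(u_{1R},u_{2R})\in\partial Q_R$ such that $(u_{1R},u_{2R})=\lambda_R S(u_{1R},u_{2R})$.
   Context: This is an eigenvalue result for the system of Hammerstein integral equations $u_i(t)=\lambda[\psi_{i0}(t)H_i[u_1,u_2]+\psi_{i1}(t)G_i[u_1,u_2]+\int_0^1K_i(t,s)F_i(s,u_1(s),u_2(s))ds]$, $i=1,2$. Under (D1)–(D5) the operator $S$ maps $Q$ into $Q$ and is compact. *)

theory Defs
  imports "HOL-Analysis.Analysis"
begin

text \<open>Elements of C[0,1] are represented as functions real => real that are continuous
on {0..1}; only their values on [0,1] matter.\<close>

definition C01 :: "(real \<Rightarrow> real) set" where
  "C01 = {x. continuous_on {0..1} x}"

definition sup_norm :: "(real \<Rightarrow> real) \<Rightarrow> real" where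
  "sup_norm x = (SUP t\<in>{0..1}. \<bar>x t\<bar>)"

definition normY :: "(real \<Rightarrow> real) \<times> (real \<Rightarrow> real) \<Rightarrow> real" where
  "normY u = max (sup_norm (fst u)) (sup_norm (snd u))"

definition Linf :: "(real \<Rightarrow> real) set" where
  "Linf = {f. f \<in> borel_measurable (lebesgue_on {0..1}) \<and>
               (\<exists>M. AE t in lebesgue_on {0..1}. \<bar>f t\<bar> \<le> M)}"

definition cone_Qi :: "real \<Rightarrow> real \<Rightarrow> real \<Rightarrow> (real \<Rightarrow> real) set" where
  "cone_Qi c a b = {x \<in> C01. (\<forall>t\<in>{0..1}. 0 \<le> x t) \<and> (INF t\<in>{a..b}. x t) \<ge> c * sup_norm x}"

definition ctil :: "(nat \<Rightarrow> real) \<Rightarrow> (nat \<Rightarrow> nat \<Rightarrow> real) \<Rightarrow> nat \<Rightarrow> real" where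
  "ctil c cc i = min (c i) (min (cc i 0) (cc i 1))"

definition coneQ :: "(nat \<Rightarrow> real) \<Rightarrow> (nat \<Rightarrow> nat \<Rightarrow> real) \<Rightarrow> (nat \<Rightarrow> real) \<Rightarrow> (nat \<Rightarrow> real)
    \<Rightarrow> ((real \<Rightarrow> real) \<times> (real \<Rightarrow> real)) set" where
  "coneQ c cc a b = {u. fst u \<in> cone_Qi (ctil c cc 1) (a 1) (b 1) \<and>
                        snd u \<in> cone_Qi (ctil c cc 2) (a 2) (b 2)}"

text \<open>Compact functional on a set Q of Y: continuous (w.r.t. the norm of Y) and mapping
bounded sets to relatively compact (= bounded, for real values) sets.\<close>
definition compact_functional ::
  "((real \<Rightarrow> real) \<times> (real \<Rightarrow> real)) set \<Rightarrow> ((real \<Rightarrow> real) \<times> (real \<Rightarrow> real) \<Rightarrow> real) \<Rightarrow> bool" where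
  "compact_functional Q H \<longleftrightarrow>
     (\<forall>u\<in>Q. \<forall>e>0. \<exists>d>0. \<forall>v\<in>Q.
        normY (\<lambda>t. fst v t - fst u t, \<lambda>t. snd v t - snd u t) < d \<longrightarrow> \<bar>H v - H u\<bar> < e) \<and>
     (\<forall>B\<subseteq>Q. (\<exists>M. \<forall>u\<in>B. normY u \<le> M) \<longrightarrow> bounded (H ` B))"

definition Sop ::
  "(nat \<Rightarrow> nat \<Rightarrow> real \<Rightarrow> real) \<Rightarrow> (nat \<Rightarrow> (real \<Rightarrow> real) \<times> (real \<Rightarrow> real) \<Rightarrow> real)
   \<Rightarrow> (nat \<Rightarrow> (real \<Rightarrow> real) \<times> (real \<Rightarrow> real) \<Rightarrow> real) \<Rightarrow> (nat \<Rightarrow> real \<Rightarrow> real \<Rightarrow> real)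
   \<Rightarrow> (nat \<Rightarrow> real \<Rightarrow> real \<Rightarrow> real \<Rightarrow> real) \<Rightarrow> nat
   \<Rightarrow> (real \<Rightarrow> real) \<times> (real \<Rightarrow> real) \<Rightarrow> real \<Rightarrow> real" where
  "Sop \<psi> H G K F i u t = \<psi> i 0 t * H i u + \<psi> i 1 t * G i u +
     integral\<^sup>L (lebesgue_on {0..1}) (\<lambda>s. K i t s * F i s (fst u s) (snd u s))"

end

theory Submission
  imports Defs "HOL-Complex_Analysis.Great_Picard"
begin

text \<open>
  This is a Birkhoff--Kellogg argument in the cone $Q$. If $\|u\| = R$ then one component $u_i$ has
  norm $R$, so it lies between $\tilde c_i R$ and $R$ on $[a_i, b_i]$, and (1)--(3) bound $\|S u\|$
  away from $0$ on $\partial Q_R$. With $e = (1,1) \in Q$, the map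
  $N u = \varphi(\|u\|)\, S (R u / \|u\|) + (R - \|u\|)\, e$, where $\varphi$ vanishes on
  $[0, R/2]$ and $\varphi(R) = 1$, is compact and bounded away from $0$ on the convex set
  $Q_R = \{u \in Q : \|u\| \le R\}$, because the norm is monotone on the cone. Schauder's theorem
  gives a fixed point of $u \mapsto R\, N u / \|N u\|$; it has norm $R$, where $N = S$.

  Schauder's theorem is reduced by finite nets to the fixed point property of the Hilbert cube, which
  follows from Kuhn's combinatorial lemma.
\<close>

section \<open>Fixed points of compact maps\<close>

text \<open>Schauder's theorem wants a self-map of a convex set, but the lower bound on
  \<open>S\<close> is available only on the sphere, which is not convex. Radial projection extends
  \<open>S\<close> to the ball minus the origin and has no limit at 0. The cutoff removes this
  singularity at the price of the lower bound near 0; the term with \<open>e\<close>, whose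
  coefficient vanishes exactly on the sphere, restores it. In a cone the two terms cannot cancel, so
  the sum stays away from 0 and can be normalised.

  The size of a finite net depends on the accuracy asked for, so the coefficient simplices have no
  common dimension. All of them sit in the sequence space \<open>nat \<Rightarrow> real\<close>, and
  one fixed point statement about its unit cube serves every net. The product topology there costs
  nothing, since each net uses only finitely many coordinates.\<close>

lemma tendsto_fun_coordinatewise:
  fixes f :: "'b \<Rightarrow> 'a \<Rightarrow> 'c::topological_space"
  shows "(f \<longlongrightarrow> l) F \<longleftrightarrow> (\<forall>i. ((\<lambda>n. f n i) \<longlongrightarrow> l i) F)"
proof -
  have "(f \<longlongrightarrow> l) F \<longleftrightarrow> limitin (product_topology (\<lambda>i. euclidean) UNIV) f l F"
    by (simp add: euclidean_product_topology)
  then show ?thesis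
    by (simp add: limitin_componentwise)
qed

lemma compact_Pi_fun:
  fixes S :: "'a \<Rightarrow> 'b::topological_space set"
  assumes "\<And>i. compact (S i)"
  shows "compact {x. \<forall>i. x i \<in> S i}"
proof -
  have "compactin (product_topology (\<lambda>i. euclidean) UNIV) (PiE UNIV S)"
    using assms by (simp add: compactin_PiE)
  moreover have "PiE UNIV S = {x. \<forall>i. x i \<in> S i}"
    by (auto simp: PiE_UNIV_domain)
  ultimately show ?thesis
    by (simp add: euclidean_product_topology)
qed

text \<open>Kuhn's lemma is applied to the grid of mesh \<open>1/p\<close> in the first \<open>p\<close> coordinates, so that dimension
  and fineness grow together and a single subsequence yields the fixed point.\<close>

theorem hilbert_cube_fixed_point:
  fixes f :: "(nat \<Rightarrow> real) \<Rightarrow> (nat \<Rightarrow> real)"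
  defines "C \<equiv> {x. \<forall>i. x i \<in> {0..1}}"
  assumes cont: "continuous_on C f" and into: "f ` C \<subseteq> C"
  shows "\<exists>x\<in>C. f x = x"
proof -
  \<comment> \<open>Coordinates from \<open>p\<close> on are set to 0. Every fixed coordinate is
    eventually below \<open>p\<close>, so this truncation is invisible to coordinatewise
    limits.\<close>
  define pt :: "nat \<Rightarrow> (nat \<Rightarrow> nat) \<Rightarrow> nat \<Rightarrow> real"
    where "pt = (\<lambda>p z i. if i < p then real (z i) / real p else 0)"
  have pt_C: "pt p z \<in> C" if "\<forall>i<p. z i \<le> p" for p z
    using that by (auto simp: pt_def C_def field_simps)
  have f01: "0 \<le> f x i \<and> f x i \<le> 1" if "x \<in> C" for x i
  proof -
    have "f x \<in> C" using into that by blast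
    then show ?thesis by (simp add: C_def)
  qed
  have "\<exists>q. (\<forall>i<p. q i < p) \<and> (\<forall>i<p. \<exists>r s. (\<forall>j<p. q j \<le> r j \<and> r j \<le> q j + 1) \<and>
          (\<forall>j<p. q j \<le> s j \<and> s j \<le> q j + 1) \<and>
          pt p r i \<le> f (pt p r) i \<and> f (pt p s) i \<le> pt p s i)" if p: "0 < p" for p :: nat
  proof -
    \<comment> \<open>Label 0 says that \<open>f\<close> does not lower the coordinate. Kuhn's lemma
      prescribes 0 on the bottom face, which is automatic because \<open>f\<close> maps into the
      cube, and 1 on the top face, which the test \<open>z i < p\<close> enforces.\<close>
    define label :: "(nat \<Rightarrow> nat) \<Rightarrow> nat \<Rightarrow> nat"
      where "label = (\<lambda>z i. if z i < p \<and> pt p z i \<le> f (pt p z) i then 0 else 1)"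
    obtain q where q: "\<forall>i<p. q i < p"
      and rs: "\<forall>i<p. \<exists>r s. (\<forall>j<p. q j \<le> r j \<and> r j \<le> q j + 1) \<and>
          (\<forall>j<p. q j \<le> s j \<and> s j \<le> q j + 1) \<and> label r i \<noteq> label s i"
    proof (rule kuhn_lemma[of p p label])
      show "\<forall>x. (\<forall>i<p. x i \<le> p) \<longrightarrow> (\<forall>i<p. x i = 0 \<longrightarrow> label x i = 0)"
        using p f01[OF pt_C] by (auto simp: label_def pt_def)
    qed (use p in \<open>auto simp: label_def\<close>)
    have l0: "pt p r i \<le> f (pt p r) i" if "label r i = 0" for r i
      using that by (auto simp: label_def split: if_splits)
    have l1: "f (pt p s) i \<le> pt p s i" if "label s i \<noteq> 0" "i < p" "\<forall>j<p. q j \<le> s j \<and> s j \<le> q j + 1" for s i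
    proof (cases "s i < p")
      case True
      then show ?thesis using that by (auto simp: label_def split: if_splits)
    next
      \<comment> \<open>Here label 1 was imposed rather than read off from \<open>f\<close>, but the
        coordinate equals 1 and \<open>f\<close> cannot exceed it.\<close>
      case False
      have *: "\<forall>j<p. s j \<le> p" using that q by fastforce
      then have "s i = p" using False \<open>i < p\<close> by force
      then have "pt p s i = 1" using \<open>i < p\<close> by (simp add: pt_def)
      then show ?thesis using f01[OF pt_C[OF *]] by simp
    qed
    have "\<exists>r s. (\<forall>j<p. q j \<le> r j \<and> r j \<le> q j + 1) \<and> (\<forall>j<p. q j \<le> s j \<and> s j \<le> q j + 1) \<and>
          pt p r i \<le> f (pt p r) i \<and> f (pt p s) i \<le> pt p s i" if "i < p" for i
    proof -
      obtain r s where r: "\<forall>j<p. q j \<le> r j \<and> r j \<le> q j + 1"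
        and s: "\<forall>j<p. q j \<le> s j \<and> s j \<le> q j + 1" and ne: "label r i \<noteq> label s i"
        using rs \<open>i < p\<close> by blast
      show ?thesis
      proof (cases "label r i = 0")
        case True
        then show ?thesis using ne r s l0[of r i] l1[of s i] \<open>i < p\<close> by (metis (no_types, lifting))
      next
        case False
        then have "label s i = 0"
          using ne by (auto simp: label_def split: if_splits)
        then show ?thesis using False r s l0[of s i] l1[of r i] \<open>i < p\<close> by (metis (no_types, lifting))
      qed
    qed
    with q show ?thesis by blast
  qed
  then obtain q where q: "\<And>p i. i < p \<Longrightarrow> q p i < p"
    and q': "\<And>p i. i < p \<Longrightarrow> \<exists>r s. (\<forall>j<p. q p j \<le> r j \<and> r j \<le> q p j + 1) \<and>
          (\<forall>j<p. q p j \<le> s j \<and> s j \<le> q p j + 1) \<and>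
          pt p r i \<le> f (pt p r) i \<and> f (pt p s) i \<le> pt p s i"
    by (metis (no_types, lifting) gr_implies_not0 neq0_conv)
  define B where "B = (\<lambda>p z. \<forall>j<p. q p j \<le> z j \<and> z j \<le> q p j + 1)"
  define L where "L = (\<lambda>p z i. pt p z i \<le> f (pt p z) i)"
  define U where "U = (\<lambda>p z i. f (pt p z) i \<le> pt p z i)"
  have "\<forall>p i. \<exists>z. i < p \<longrightarrow> B p (fst z) \<and> B p (snd z) \<and> L p (fst z) i \<and> U p (snd z) i"
    using q' by (simp add: B_def L_def U_def)
  then obtain z where z: "\<And>p i. i < p \<Longrightarrow>
      B p (fst (z p i)) \<and> B p (snd (z p i)) \<and> L p (fst (z p i)) i \<and> U p (snd (z p i)) i"
    unfolding choice_iff by blast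
  define r s where "r = (\<lambda>p i. fst (z p i))" and "s = (\<lambda>p i. snd (z p i))"
  from z have
        r: "\<And>p i j. i < p \<Longrightarrow> j < p \<Longrightarrow> q p j \<le> r p i j \<and> r p i j \<le> q p j + 1"
    and s: "\<And>p i j. i < p \<Longrightarrow> j < p \<Longrightarrow> q p j \<le> s p i j \<and> s p i j \<le> q p j + 1"
    and fr: "\<And>p i. i < p \<Longrightarrow> pt p (r p i) i \<le> f (pt p (r p i)) i"
    and fs: "\<And>p i. i < p \<Longrightarrow> f (pt p (s p i)) i \<le> pt p (s p i) i"
    by (simp_all add: B_def L_def U_def r_def s_def)
  have "compact C"
    unfolding C_def by (rule compact_Pi_fun) simp
  moreover have "\<forall>p. pt p (q p) \<in> C"
    using q by (auto intro!: pt_C less_imp_le)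
  ultimately obtain x k where x: "x \<in> C" and k: "strict_mono k"
    and lim: "((\<lambda>p. pt p (q p)) \<circ> k) \<longlonglongrightarrow> x"
    unfolding compact_eq_seq_compact_metric seq_compact_def by metis
  \<comment> \<open>Corners of one cell differ by at most \<open>1 / k n\<close> in each coordinate,
    and a fixed coordinate \<open>j\<close> is below \<open>k n\<close> for large \<open>n\<close>.
    Hence every choice of corners inherits the limit of \<open>q\<close>; both the upper and the
    lower inequality can then be passed to the same point \<open>x\<close>.\<close>
  have near: "(\<lambda>n. pt (k n) (z (k n))) \<longlonglongrightarrow> x"
    if z: "\<And>p j. i < p \<Longrightarrow> j < p \<Longrightarrow> q p j \<le> z p j \<and> z p j \<le> q p j + 1" for z i
    unfolding tendsto_fun_coordinatewise
  proof
    fix j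
    have "(\<lambda>n. pt (k n) (q (k n)) j) \<longlonglongrightarrow> x j"
      using lim unfolding tendsto_fun_coordinatewise by (simp add: o_def)
    moreover have "(\<lambda>n. pt (k n) (z (k n)) j - pt (k n) (q (k n)) j) \<longlonglongrightarrow> 0"
    proof (rule Lim_null_comparison)
      show "\<forall>\<^sub>F n in sequentially. norm (pt (k n) (z (k n)) j - pt (k n) (q (k n)) j) \<le> 1 / real (k n)"
      proof (rule eventually_sequentiallyI[of "Suc (i + j)"])
        fix n assume "Suc (i + j) \<le> n"
        then have "i < k n" "j < k n"
          using seq_suble[OF k, of n] by auto
        then show "norm (pt (k n) (z (k n)) j - pt (k n) (q (k n)) j) \<le> 1 / real (k n)"
          using z[of "k n" j] by (auto simp: pt_def diff_divide_distrib[symmetric] divide_right_mono)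
      qed
      show "(\<lambda>n. 1 / real (k n)) \<longlonglongrightarrow> 0"
        using LIMSEQ_subseq_LIMSEQ[OF lim_1_over_n k] by (simp add: o_def)
    qed
    ultimately have "(\<lambda>n. pt (k n) (q (k n)) j + (pt (k n) (z (k n)) j - pt (k n) (q (k n)) j)) \<longlonglongrightarrow> x j + 0"
      by (rule tendsto_add)
    then show "(\<lambda>n. pt (k n) (z (k n)) j) \<longlonglongrightarrow> x j"
      by simp
  qed
  have flim: "(\<lambda>n. f (pt (k n) (z (k n))) i) \<longlonglongrightarrow> f x i" "(\<lambda>n. pt (k n) (z (k n)) i) \<longlonglongrightarrow> x i"
    if z: "\<And>p j. i < p \<Longrightarrow> j < p \<Longrightarrow> q p j \<le> z p j \<and> z p j \<le> q p j + 1" for z i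
  proof -
    have nz: "(\<lambda>n. pt (k n) (z (k n))) \<longlonglongrightarrow> x"
      by (rule near[of i]) (rule z)
    have "\<forall>\<^sub>F n in sequentially. pt (k n) (z (k n)) \<in> C"
    proof (rule eventually_sequentiallyI[of "Suc i"])
      fix n assume "Suc i \<le> n"
      then have "i < k n"
        using seq_suble[OF k, of n] by auto
      then have "\<forall>j<k n. z (k n) j \<le> k n"
        using z[of "k n"] q[of _ "k n"] by fastforce
      then show "pt (k n) (z (k n)) \<in> C"
        by (rule pt_C)
    qed
    then have "(\<lambda>n. f (pt (k n) (z (k n)))) \<longlonglongrightarrow> f x"
      by (rule continuous_on_tendsto_compose[OF cont nz x])
    then show "(\<lambda>n. f (pt (k n) (z (k n))) i) \<longlonglongrightarrow> f x i"
      by (simp add: tendsto_fun_coordinatewise)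
    show "(\<lambda>n. pt (k n) (z (k n)) i) \<longlonglongrightarrow> x i"
      using nz by (simp add: tendsto_fun_coordinatewise)
  qed
  have "f x i = x i" for i
  proof (rule antisym)
    have ev: "\<forall>\<^sub>F n in sequentially. i < k n"
      by (rule eventually_sequentiallyI[of "Suc i"]) (meson k le_trans seq_suble Suc_le_eq)
    show "f x i \<le> x i"
      by (rule tendsto_le[OF _ flim(2,1)[of i "\<lambda>p. s p i"]])
         (use s in \<open>auto intro: eventually_mono[OF ev] fs\<close>)
    show "x i \<le> f x i"
      by (rule tendsto_le[OF _ flim(1,2)[of i "\<lambda>p. r p i"]])
         (use r in \<open>auto intro: eventually_mono[OF ev] fr\<close>)
  qed
  with x show ?thesis by blast
qed

text \<open>The Schauder projection onto a finite net of \<open>K\<close> moves each point of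
  \<open>K\<close> by less than \<open>e\<close>. Composed with \<open>T\<close> it acts on finitely
  many coefficients, where the cube theorem applies and yields approximate fixed points. Compactness
  of \<open>K\<close> makes the values \<open>T (u n)\<close> converge along a subsequence; the
  points \<open>u n\<close> follow them, and continuity turns the limit into a fixed point.\<close>

theorem schauder_fixed_point:
  fixes T :: "'a::real_normed_vector \<Rightarrow> 'a"
  assumes D: "convex D" "D \<noteq> {}" and cont: "continuous_on D T"
    and TK: "T ` D \<subseteq> K" and K: "compact K" "K \<subseteq> D"
  shows "\<exists>x\<in>D. T x = x"
proof -
  have approx: "\<exists>u\<in>D. norm (T u - u) < e" if e: "0 < e" for e
  proof -
    obtain Y where Y: "finite Y" "Y \<subseteq> K" "K \<subseteq> (\<Union>y\<in>Y. ball y e)"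
      using compactE_image[of K K "\<lambda>y. ball y e"] K e by (metis UN_I centre_in_ball open_ball subsetI)
    have "Y \<noteq> {}"
      using D TK Y by auto
    obtain n y where n: "Y = y ` {i::nat. i < n}"
      using finite_imp_nat_seg_image_inj_on[OF \<open>finite Y\<close>] by metis
    then have yK: "y i \<in> K" if "i < n" for i
      using Y that by auto
    have "0 < n" using n \<open>Y \<noteq> {}\<close> by auto
    define C :: "(nat \<Rightarrow> real) set" where "C = {x. \<forall>i. x i \<in> {0..1}}"
    \<comment> \<open>Tent weights of radius \<open>e\<close> around the net points. As the net
      covers \<open>K\<close>, at least one weight is positive at each point of \<open>K\<close>, so
      their sum \<open>M\<close> can serve as a denominator.\<close>
    define m where "m = (\<lambda>x i. max 0 (e - norm (x - y i)))"
    define M where "M = (\<lambda>x. \<Sum>i<n. m x i)"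
    \<comment> \<open>The cube is larger than the simplex, but \<open>\<sigma>\<close> must send all
      of it into \<open>D\<close>. An excess of total mass is divided away and a deficit is given to
      \<open>y 0\<close>, so the result is always a convex combination; on the simplex it is the
      plain sum.\<close>
    define \<sigma> where "\<sigma> = (\<lambda>l::nat \<Rightarrow> real. (1 / max 1 (\<Sum>i<n. l i)) *\<^sub>R
        ((\<Sum>i<n. l i *\<^sub>R y i) + max 0 (1 - (\<Sum>i<n. l i)) *\<^sub>R y 0))"
    \<comment> \<open>A fixed point of \<open>f\<close> has coefficients summing to 1, and
      \<open>\<sigma> l\<close> is then exactly the Schauder projection of
      \<open>T (\<sigma> l)\<close>.\<close>
    define f where "f = (\<lambda>l i. if i < n then m (T (\<sigma> l)) i / M (T (\<sigma> l)) else 0)"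
    have m0: "0 \<le> m x i" for x i by (simp add: m_def)
    have Mpos: "0 < M x" if xK: "x \<in> K" for x
    proof -
      obtain i where i: "i < n" "dist (y i) x < e"
        using xK Y n by auto
      then have "0 < m x i"
        by (simp add: m_def dist_norm norm_minus_commute)
      also have "m x i \<le> M x"
        unfolding M_def using i m0 by (intro member_le_sum) auto
      finally show ?thesis .
    qed
    have mM: "m x i \<le> M x" if "i < n" for x i
      unfolding M_def using that m0 by (intro member_le_sum) auto
    have \<sigma>D: "\<sigma> l \<in> D" if l: "l \<in> C" for l
    proof -
      define w where "w = (\<lambda>i. (l i + (if i = 0 then max 0 (1 - (\<Sum>i<n. l i)) else 0)) / max 1 (\<Sum>i<n. l i))"
      have "\<sigma> l = (\<Sum>i<n. w i *\<^sub>R y i)"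
        using \<open>0 < n\<close>
        by (simp add: \<sigma>_def w_def scaleR_add_left add_divide_distrib sum.distrib scaleR_sum_right
            scaleR_add_right if_distrib[of "\<lambda>x. x / _"] if_distrib[of "\<lambda>x. x *\<^sub>R _"] cong: if_cong)
      also have "\<dots> \<in> D"
      proof (rule convex_sum)
        have "(\<Sum>i<n. w i) = ((\<Sum>i<n. l i) + max 0 (1 - (\<Sum>i<n. l i))) / max 1 (\<Sum>i<n. l i)"
          using \<open>0 < n\<close> by (simp add: w_def sum_divide_distrib[symmetric] sum.distrib)
        also have "\<dots> = 1" by (simp add: max_def)
        finally show "(\<Sum>i<n. w i) = 1" .
        show "0 \<le> w i" for i
          using l unfolding w_def C_def by (intro divide_nonneg_nonneg add_nonneg_nonneg) auto
      qed (use D yK K in auto)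
      finally show ?thesis .
    qed
    have co: "continuous_on C (\<lambda>l. l i)" for i
      by (rule continuous_on_product_then_coordinatewise) (rule continuous_on_id)
    have "continuous_on C \<sigma>"
      unfolding \<sigma>_def by (intro continuous_intros co) auto
    then have cT: "continuous_on C (\<lambda>l. T (\<sigma> l))"
      using continuous_on_compose2[OF cont] \<sigma>D by blast
    have "\<exists>l\<in>{x. \<forall>i. x i \<in> {0..1}}. f l = l"
    proof (rule hilbert_cube_fixed_point; fold C_def)
      show "continuous_on C f"
      proof (rule continuous_on_coordinatewise_then_product)
        fix i
        have "M (T (\<sigma> l)) \<noteq> 0" if "l \<in> C" for l
          using Mpos TK \<sigma>D that by (metis image_subset_iff less_irrefl)
        then show "continuous_on C (\<lambda>l. f l i)"
          by (cases "i < n") (auto simp: f_def m_def M_def intro!: continuous_intros cT)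
      qed
      show "f ` C \<subseteq> C"
      proof clarify
        fix l assume "l \<in> C"
        then have "0 < M (T (\<sigma> l))" using Mpos TK \<sigma>D by blast
        then show "f l \<in> C" using m0 mM by (auto simp: C_def f_def)
      qed
    qed
    then obtain l where l: "l \<in> C" "f l = l" by (auto simp: C_def)
    define u where "u = \<sigma> l"
    have uD: "u \<in> D" and Tu: "T u \<in> K" using \<sigma>D[OF l(1)] TK by (auto simp: u_def)
    have li: "l i = m (T u) i / M (T u)" if "i < n" for i
      using fun_cong[OF l(2), of i] that by (simp add: f_def u_def)
    have Mp: "0 < M (T u)" using Mpos Tu .
    have s1: "(\<Sum>i<n. l i) = 1"
      using Mp by (simp add: li sum_divide_distrib[symmetric]) (simp add: M_def)
    then have u: "u = (\<Sum>i<n. l i *\<^sub>R y i)"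
      by (simp add: u_def \<sigma>_def)
    have "T u = (\<Sum>i<n. l i) *\<^sub>R T u" by (simp add: s1)
    then have "T u - u = (\<Sum>i<n. l i *\<^sub>R (T u - y i))"
      unfolding u by (simp add: scaleR_sum_left scaleR_diff_right sum_subtractf)
    also have "norm \<dots> \<le> (\<Sum>i<n. norm (l i *\<^sub>R (T u - y i)))"
      by (rule norm_sum)
    also have "\<dots> < (\<Sum>i<n. l i * e)"
    proof (rule sum_strict_mono_ex1)
      have pos: "0 \<le> l i" for i using l by (auto simp: C_def)
      \<comment> \<open>Only net points closer than \<open>e\<close> to \<open>T u\<close> carry
        weight, so \<open>u\<close> is an average of such points.\<close>
      have lt: "norm (T u - y i) < e" if "i < n" "l i \<noteq> 0" for i
        using that by (auto simp: li m_def max_def split: if_splits)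
      show "\<forall>i\<in>{..<n}. norm (l i *\<^sub>R (T u - y i)) \<le> l i * e"
      proof
        fix i assume "i \<in> {..<n}"
        then show "norm (l i *\<^sub>R (T u - y i)) \<le> l i * e"
          using pos[of i] lt[of i] by (cases "l i = 0") (auto intro!: mult_left_mono)
      qed
      obtain i where i: "i < n" "l i \<noteq> 0" using s1 by (metis lessThan_iff sum.neutral zero_neq_one)
      then show "\<exists>i\<in>{..<n}. norm (l i *\<^sub>R (T u - y i)) < l i * e"
        using pos[of i] lt[of i] by (intro bexI[of _ i]) auto
    qed simp
    also have "\<dots> = e" by (simp add: s1 sum_distrib_right[symmetric])
    finally show ?thesis using uD by blast
  qed
  then have "\<forall>n::nat. \<exists>u. u \<in> D \<and> norm (T u - u) < 1 / real (Suc n)"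
    by (simp add: Bex_def)
  then obtain u where u: "\<And>n. u n \<in> D" "\<And>n::nat. norm (T (u n) - u n) < 1 / real (Suc n)"
    unfolding choice_iff by blast
  have "\<forall>n. T (u n) \<in> K" using u TK by blast
  then obtain x k where x: "x \<in> K" and k: "strict_mono k" and lim: "((\<lambda>n. T (u n)) \<circ> k) \<longlonglongrightarrow> x"
    using K unfolding compact_eq_seq_compact_metric seq_compact_def by metis
  have "(\<lambda>n. T (u n) - u n) \<longlonglongrightarrow> 0"
    by (rule Lim_null_comparison[OF _ LIMSEQ_Suc[OF lim_1_over_n]])
       (use u(2) in \<open>auto intro!: always_eventually less_imp_le\<close>)
  from tendsto_diff[OF lim LIMSEQ_subseq_LIMSEQ[OF this k]]
  have ux: "(\<lambda>n. u (k n)) \<longlonglongrightarrow> x" by (simp add: o_def)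
  have "(\<lambda>n. T (u (k n))) \<longlonglongrightarrow> T x"
    using continuous_on_tendsto_compose[OF cont ux] x K u by auto
  with lim have "T x = x"
    by (intro LIMSEQ_unique) (auto simp: o_def)
  with x K show ?thesis by blast
qed


text \<open>The functional \<open>p\<close> plays the role of the norm. It need not be definite: below it is the supremum
  over \<open>[0,1]\<close> of functions defined on the whole line.\<close>

theorem birkhoff_kellogg_cone:
  fixes S :: "'a::real_normed_vector \<Rightarrow> 'a" and p :: "'a \<Rightarrow> real"
  assumes Q_add: "\<And>x y. x \<in> Q \<Longrightarrow> y \<in> Q \<Longrightarrow> x + y \<in> Q"
    and Q_scale: "\<And>c x. x \<in> Q \<Longrightarrow> 0 \<le> c \<Longrightarrow> c *\<^sub>R x \<in> Q"
    and p_cont: "continuous_on Q p"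
    and p_scale: "\<And>c x. x \<in> Q \<Longrightarrow> 0 \<le> c \<Longrightarrow> p (c *\<^sub>R x) = c * p x"
    and p_add: "\<And>x y. x \<in> Q \<Longrightarrow> y \<in> Q \<Longrightarrow> p (x + y) \<le> p x + p y"
    and p_mono: "\<And>x y. x \<in> Q \<Longrightarrow> y \<in> Q \<Longrightarrow> p x \<le> p (x + y)"
    and e: "e \<in> Q" "0 < p e"
    and R: "0 < R"
    and S_cont: "continuous_on {x \<in> Q. p x = R} S"
    and S_into: "S ` {x \<in> Q. p x = R} \<subseteq> C" and C: "compact C" "C \<subseteq> Q"
    and m: "0 < m" and S_lower: "\<And>x. x \<in> Q \<Longrightarrow> p x = R \<Longrightarrow> m \<le> p (S x)"
  shows "\<exists>x\<in>Q. p x = R \<and> (\<exists>l>0. x = l *\<^sub>R S x)"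
proof -
  define D where "D = {x \<in> Q. p x \<le> R}"
  define s where "s = (\<lambda>u. (R / p u) *\<^sub>R u)"
  \<comment> \<open>The ramp \<open>2 * p u / R - 1\<close> runs from 0 at \<open>R / 2\<close> to 1
    at \<open>R\<close>: the branches agree at the seam, and the division by \<open>p u\<close>
    inside \<open>s\<close> is performed only away from 0.\<close>
  define g where "g = (\<lambda>u. if p u \<le> R / 2 then 0 else (2 * p u / R - 1) *\<^sub>R S (s u))"
  define N where "N = (\<lambda>u. g u + (R - p u) *\<^sub>R e)"
  define \<nu> where "\<nu> = (\<lambda>z. (R / p z) *\<^sub>R z)"
  \<comment> \<open>The two cases split at \<open>p u = 3 * R / 4\<close>. Above it the ramp is at
    least 1/2 and the \<open>S\<close> term gives \<open>m / 2\<close>; below it the coefficient of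
    \<open>e\<close> exceeds \<open>R / 4\<close>.\<close>
  define m0 where "m0 = min (m / 2) (R / 4 * p e)"
  \<comment> \<open>All values of \<open>N\<close> have this form with parameters in a compact set,
    so \<open>A\<close> is compact. The closed part \<open>A'\<close> excludes the zeros of
    \<open>p\<close>; \<open>\<nu>\<close> is continuous on it, and its image is the compact set for
    Schauder's theorem.\<close>
  define A where "A = (\<lambda>(t, y, r). t *\<^sub>R y + r *\<^sub>R e) ` ({0..1} \<times> C \<times> {0..R})"
  define A' where "A' = {z \<in> A. m0 \<le> p z}"
  have Q0: "0 \<in> Q" using Q_scale[OF e(1), of 0] by simp
  have "p 0 = 0" using p_scale[OF e(1), of 0] by simp
  then have p_nonneg: "0 \<le> p x" if "x \<in> Q" for x
    using p_mono[OF Q0 that] by simp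
  have p_mono': "p y \<le> p (x + y)" if "x \<in> Q" "y \<in> Q" for x y
    using p_mono[OF that(2,1)] by (simp add: add.commute)
  have m0: "0 < m0" using m R e by (simp add: m0_def)
  have \<nu>: "\<nu> z \<in> Q" "p (\<nu> z) = R" if "z \<in> Q" "0 < p z" for z
    using that R by (auto simp: \<nu>_def p_scale intro!: Q_scale)
  have s: "s u \<in> Q" "p (s u) = R" if "u \<in> Q" "0 < p u" for u
    using \<nu>[OF that] by (auto simp: s_def \<nu>_def)
  have A_Q: "A \<subseteq> Q"
    using C e by (auto simp: A_def intro!: Q_add Q_scale)
  have g_form: "\<exists>t\<in>{0..1}. \<exists>y\<in>C. g u = t *\<^sub>R y" if u: "u \<in> D" for u
  proof (cases "p u \<le> R / 2")
    case True
    \<comment> \<open>The value 0 has to be written as \<open>0 *\<^sub>R y\<close> with some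
      \<open>y \<in> C\<close>; rescaling \<open>e\<close> to the sphere shows that \<open>C\<close>
      has an element.\<close>
    have "S (s e) \<in> C" using s[OF e] S_into by blast
    then show ?thesis using True by (force simp: g_def)
  next
    case False
    then have "S (s u) \<in> C" "0 \<le> 2 * p u / R - 1" "2 * p u / R - 1 \<le> 1"
      using u R s[of u] S_into by (auto simp: D_def field_simps)
    then show ?thesis using False by (force simp: g_def)
  qed
  have N_A: "N u \<in> A" if u: "u \<in> D" for u
  proof -
    obtain t y where "t \<in> {0..1}" "y \<in> C" "g u = t *\<^sub>R y" using g_form[OF u] by blast
    moreover have "R - p u \<in> {0..R}" using u p_nonneg by (auto simp: D_def)
    ultimately show ?thesis unfolding A_def N_def by (force intro!: image_eqI[where x = "(t, y, R - p u)"])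
  qed
  have N_lower: "m0 \<le> p (N u)" if u: "u \<in> D" for u
  proof -
    have gQ: "g u \<in> Q" using g_form[OF u] C Q_scale by force
    have eQ: "(R - p u) *\<^sub>R e \<in> Q" using u e by (auto simp: D_def intro!: Q_scale)
    show ?thesis
    proof (cases "3 * R / 4 \<le> p u")
      case True
      then have pu: "0 < p u" "\<not> p u \<le> R / 2" and t: "1/2 \<le> 2 * p u / R - 1"
        using R by (auto simp: field_simps)
      have uQ: "u \<in> Q" using u by (simp add: D_def)
      have "S (s u) \<in> Q" using s[OF uQ pu(1)] S_into C by blast
      then have "p (g u) = (2 * p u / R - 1) * p (S (s u))"
        using pu t by (simp add: g_def p_scale)
      moreover have "1/2 * m \<le> (2 * p u / R - 1) * p (S (s u))"
        using t m S_lower[OF s[OF uQ pu(1)]] by (intro mult_mono) auto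
      ultimately show ?thesis
        using p_mono[OF gQ eQ] by (simp add: N_def m0_def)
    next
      case False
      have "R / 4 * p e \<le> (R - p u) * p e"
        using False e by (intro mult_right_mono) auto
      also have "\<dots> = p ((R - p u) *\<^sub>R e)"
        using u e by (simp add: p_scale D_def)
      also have "\<dots> \<le> p (N u)"
        unfolding N_def by (rule p_mono'[OF gQ eQ])
      finally show ?thesis by (simp add: m0_def)
    qed
  qed
  have p_D: "continuous_on D p"
    using p_cont by (rule continuous_on_subset) (auto simp: D_def)
  have "continuous_on D g"
    unfolding g_def
  proof (rule continuous_on_cases_le)
    show "continuous_on {u \<in> D. R / 2 \<le> p u} (\<lambda>u. (2 * p u / R - 1) *\<^sub>R S (s u))"
    proof (intro continuous_intros)
      show c: "continuous_on {u \<in> D. R / 2 \<le> p u} p"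
        using p_D by (rule continuous_on_subset) auto
      have "continuous_on {u \<in> D. R / 2 \<le> p u} s"
        unfolding s_def by (intro continuous_intros c) (use R in auto)
      moreover have "s ` {u \<in> D. R / 2 \<le> p u} \<subseteq> {x \<in> Q. p x = R}"
        using s R by (auto simp: D_def)
      ultimately show "continuous_on {u \<in> D. R / 2 \<le> p u} (\<lambda>u. S (s u))"
        using continuous_on_compose2[OF S_cont] by blast
    qed (use R in auto)
  qed (use p_D R in auto)
  then have N_cont: "continuous_on D N"
    unfolding N_def by (intro continuous_intros p_D)
  have \<nu>_cont: "continuous_on A' \<nu>"
    unfolding \<nu>_def
    by (intro continuous_intros continuous_on_subset[OF p_cont]) (use A_Q m0 in \<open>auto simp: A'_def\<close>)
  have "\<exists>u\<in>D. \<nu> (N u) = u"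
  proof (rule schauder_fixed_point)
    have "0 \<in> D" using Q0 \<open>p 0 = 0\<close> R by (simp add: D_def)
    then show "D \<noteq> {}" by blast
    show "convex D"
    proof (rule convexI)
      fix x y and u v :: real
      assume xy: "x \<in> D" "y \<in> D" and uv: "0 \<le> u" "0 \<le> v" "u + v = 1"
      then have q: "u *\<^sub>R x \<in> Q" "v *\<^sub>R y \<in> Q" by (auto simp: D_def intro!: Q_scale)
      have "p (u *\<^sub>R x + v *\<^sub>R y) \<le> u * p x + v * p y"
        using p_add[OF q] xy uv by (simp add: p_scale D_def)
      also have "\<dots> \<le> u * R + v * R"
        using xy uv by (intro add_mono mult_left_mono) (auto simp: D_def)
      also have "\<dots> = R" using uv by (simp flip: distrib_right)
      finally show "u *\<^sub>R x + v *\<^sub>R y \<in> D" using Q_add[OF q] by (simp add: D_def)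
    qed
    have NA': "N ` D \<subseteq> A'" using N_A N_lower by (auto simp: A'_def)
    then show "continuous_on D (\<lambda>u. \<nu> (N u))"
      using continuous_on_compose2[OF \<nu>_cont N_cont] by blast
    show "(\<lambda>u. \<nu> (N u)) ` D \<subseteq> \<nu> ` A'" using NA' by blast
    have "compact A"
      unfolding A_def case_prod_unfold
      by (intro compact_continuous_image continuous_intros compact_Times C) auto
    moreover have "closed A'"
      using continuous_closed_preimage[OF continuous_on_subset[OF p_cont A_Q] compact_imp_closed[OF \<open>compact A\<close>], of "{m0..}"]
      by (simp add: A'_def vimage_def Int_def)
    ultimately have "compact A'"
      using compact_Int_closed[of A A'] by (simp add: A'_def Int_def)
    then show "compact (\<nu> ` A')" using \<nu>_cont by (rule compact_continuous_image[rotated])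
    show "\<nu> ` A' \<subseteq> D"
      using \<nu> A_Q m0 by (force simp: A'_def D_def)
  qed
  then obtain u where u: "u \<in> D" "\<nu> (N u) = u" by blast
  have "N u \<in> Q" "0 < p (N u)" using N_A[OF u(1)] A_Q N_lower[OF u(1)] m0 by auto
  from \<nu>[OF this] u(2) have uQ: "u \<in> Q" and pu: "p u = R" by auto
  have "N u = S u" using pu R by (simp add: N_def g_def s_def)
  with u(2) have "u = (R / p (S u)) *\<^sub>R S u" by (simp add: \<nu>_def)
  moreover have "0 < R / p (S u)" using S_lower[OF uQ pu] m R by simp
  ultimately show ?thesis using uQ pu by blast
qed

section \<open>Measurability\<close>

text \<open>Lebesgue measure restricted to a measurable set is complete, so changing a function on a
  null set alters each preimage only by measurable sets.\<close>

lemma borel_measurable_lebesgue_on_AE: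
  fixes f g :: "'a::euclidean_space \<Rightarrow> real"
  assumes S: "S \<in> sets lebesgue" and f: "f \<in> borel_measurable (lebesgue_on S)"
    and ae: "AE x in lebesgue_on S. f x = g x"
  shows "g \<in> borel_measurable (lebesgue_on S)"
proof -
  interpret complete_measure "lebesgue_on S"
  proof
    fix A B assume "B \<subseteq> A" "A \<in> null_sets (lebesgue_on S)"
    then have "B \<subseteq> S" "B \<in> null_sets lebesgue"
      using S completion.complete2[of B A lborel] by (auto simp: null_sets_restrict_space)
    then show "B \<in> sets (lebesgue_on S)"
      using S by (metis null_sets_restrict_space null_setsD2)
  qed
  show ?thesis
  proof (rule measurableI)
    fix T :: "real set" assume T: "T \<in> sets borel"
    show "g -` T \<inter> space (lebesgue_on S) \<in> sets (lebesgue_on S)"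
    proof (rule in_sets_AE)
      show "f -` T \<inter> space (lebesgue_on S) \<in> sets (lebesgue_on S)"
        using f T by (rule measurable_sets)
      show "AE x in lebesgue_on S. (x \<in> f -` T \<inter> space (lebesgue_on S)) \<longleftrightarrow>
          (x \<in> g -` T \<inter> space (lebesgue_on S))"
        using ae by eventually_elim auto
    qed simp
  qed simp
qed

lemma floor_approx_tendsto:
  fixes x :: real
  assumes "0 \<le> x"
  shows "(\<lambda>n. real (nat \<lfloor>real (Suc n) * x\<rfloor>) / real (Suc n)) \<longlonglongrightarrow> x"
proof -
  have "(\<lambda>n. real (nat \<lfloor>real (Suc n) * x\<rfloor>) / real (Suc n) - x) \<longlonglongrightarrow> 0"
  proof (rule Lim_null_comparison[OF _ LIMSEQ_Suc[OF lim_1_over_n]], rule always_eventually, rule allI)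
    fix n
    define y where "y = real (Suc n) * x"
    have y: "0 \<le> y" "x = y / real (Suc n)" using assms by (auto simp: y_def)
    have "\<bar>real (nat \<lfloor>y\<rfloor>) - y\<bar> \<le> 1" using y(1) by linarith
    then have "\<bar>real (nat \<lfloor>y\<rfloor>) - y\<bar> / real (Suc n) \<le> 1 / real (Suc n)"
      by (intro divide_right_mono) auto
    also have "\<bar>real (nat \<lfloor>y\<rfloor>) - y\<bar> / real (Suc n) = norm (real (nat \<lfloor>y\<rfloor>) / real (Suc n) - x)"
      by (simp add: y(2) diff_divide_distrib[symmetric])
    finally show "norm (real (nat \<lfloor>real (Suc n) * x\<rfloor>) / real (Suc n) - x) \<le> 1 / real (Suc n)"
      by (simp add: y_def)
  qed
  then show ?thesis by (simp add: LIM_zero_iff)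
qed

lemma continuous_on_quadrant_tendsto:
  fixes f :: "real \<Rightarrow> real \<Rightarrow> real"
  assumes "continuous_on ({0..} \<times> {0..}) (\<lambda>p. f (fst p) (snd p))"
    and "X \<longlonglongrightarrow> x" "Y \<longlonglongrightarrow> y" "\<And>n. 0 \<le> X n" "\<And>n. 0 \<le> Y n"
  shows "(\<lambda>n. f (X n) (Y n)) \<longlonglongrightarrow> f x y"
proof -
  have "0 \<le> x" "0 \<le> y" using assms by (auto intro: LIMSEQ_le_const)
  then have "(\<lambda>n. f (fst (X n, Y n)) (snd (X n, Y n))) \<longlonglongrightarrow> f (fst (x, y)) (snd (x, y))"
    using assms by (intro continuous_on_tendsto_compose[OF assms(1)] tendsto_Pair always_eventually) auto
  then show ?thesis by simp
qed

text \<open>Rounding \<open>u\<close> and \<open>v\<close> down to multiples of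
  \<open>1 / Suc n\<close> leaves countably many constants to substitute, one argument at a time,
  and rounding down keeps them in the quadrant. Continuity gives the limit for almost every
  \<open>t\<close> only, so completeness of the measure finishes the argument.\<close>

lemma caratheodory_measurable:
  fixes f :: "'a::euclidean_space \<Rightarrow> real \<Rightarrow> real \<Rightarrow> real"
  assumes S: "S \<in> sets lebesgue"
    and meas: "\<And>x y. 0 \<le> x \<Longrightarrow> 0 \<le> y \<Longrightarrow> (\<lambda>t. f t x y) \<in> borel_measurable (lebesgue_on S)"
    and cont: "AE t in lebesgue_on S. continuous_on ({0..} \<times> {0..}) (\<lambda>p. f t (fst p) (snd p))"
    and u: "u \<in> borel_measurable (lebesgue_on S)" "\<And>t. t \<in> S \<Longrightarrow> 0 \<le> u t"
    and v: "v \<in> borel_measurable (lebesgue_on S)" "\<And>t. t \<in> S \<Longrightarrow> 0 \<le> v t"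
  shows "(\<lambda>t. f t (u t) (v t)) \<in> borel_measurable (lebesgue_on S)"
proof -
  define g where "g = (\<lambda>n t. f t (real (nat \<lfloor>real (Suc n) * u t\<rfloor>) / real (Suc n))
                                  (real (nat \<lfloor>real (Suc n) * v t\<rfloor>) / real (Suc n)))"
  have "g n \<in> borel_measurable (lebesgue_on S)" for n
  proof -
    have fl: "(\<lambda>t. nat \<lfloor>real (Suc n) * w t\<rfloor>) \<in> measurable (lebesgue_on S) (count_space UNIV)"
      if "w \<in> borel_measurable (lebesgue_on S)" for w
      using that by measurable
    have "(\<lambda>t. f t (real i / real (Suc n)) (real (nat \<lfloor>real (Suc n) * v t\<rfloor>) / real (Suc n)))
        \<in> borel_measurable (lebesgue_on S)" for i :: nat
      by (rule measurable_compose_countable[where f = "\<lambda>j t. f t (real i / real (Suc n)) (real j / real (Suc n))",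
            OF _ fl[OF v(1)]]) (intro meas, auto)
    then show ?thesis
      unfolding g_def
      by (rule measurable_compose_countable[where
            f = "\<lambda>i t. f t (real i / real (Suc n)) (real (nat \<lfloor>real (Suc n) * v t\<rfloor>) / real (Suc n))",
            OF _ fl[OF u(1)]])
  qed
  then have lim: "(\<lambda>t. lim (\<lambda>n. g n t)) \<in> borel_measurable (lebesgue_on S)"
    by (rule borel_measurable_lim_metric)
  show ?thesis
  proof (rule borel_measurable_lebesgue_on_AE[OF S lim])
    show "AE t in lebesgue_on S. lim (\<lambda>n. g n t) = f t (u t) (v t)"
      using cont AE_space
    proof eventually_elim
      case (elim t)
      then have "(\<lambda>n. g n t) \<longlonglongrightarrow> f t (u t) (v t)"
        unfolding g_def
        by (intro continuous_on_quadrant_tendsto[OF elim(1)] floor_approx_tendsto u v) auto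
      then show ?case by (rule limI)
    qed
  qed
qed

text \<open>A Borel function equal to \<open>g\<close> almost everywhere has Borel sections. By
  Fubini almost every section of \<open>g\<close> agrees almost everywhere with the corresponding
  Borel section, which suffices for Lebesgue measurability.\<close>

lemma AE_section_lebesgue_measurable:
  fixes g :: "real \<times> real \<Rightarrow> real"
  assumes "g \<in> borel_measurable lebesgue"
  shows "AE t in lborel. (\<lambda>s. g (t, s)) \<in> borel_measurable lebesgue"
proof -
  obtain h where h: "h \<in> borel_measurable lborel" and ae: "AE p in lborel. g p = h p"
    using completion_ex_borel_measurable_real[OF assms] by blast
  have "AE p in lborel \<Otimes>\<^sub>M lborel. g p = h p"
    using ae unfolding lborel_prod .
  then have "AE t in lborel. AE s in lborel. g (t, s) = h (t, s)"
    by (rule lborel_pair.AE_pair)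
  then show ?thesis
  proof eventually_elim
    case (elim t)
    have "(\<lambda>s. h (t, s)) \<in> borel_measurable lborel"
      using h by measurable
    then have "(\<lambda>s. h (t, s)) \<in> borel_measurable (lebesgue_on UNIV)"
      by (simp add: lebesgue_on_UNIV_eq measurable_completion)
    moreover have "AE s in lborel. h (t, s) = g (t, s)"
      using elim by eventually_elim simp
    then have "AE s in lebesgue_on UNIV. h (t, s) = g (t, s)"
      unfolding lebesgue_on_UNIV_eq by (rule AE_completion)
    ultimately show ?case
      using borel_measurable_lebesgue_on_AE[of UNIV] by (simp add: lebesgue_on_UNIV_eq)
  qed
qed

text \<open>Fubini gives measurability of almost every section only; continuity in the first variable
  transfers it to all of them, because a set of full measure is dense.\<close>

lemma kernel_section_measurable:
  fixes k :: "real \<Rightarrow> real \<Rightarrow> real"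
  assumes meas: "(\<lambda>p. k (fst p) (snd p)) \<in> borel_measurable (lebesgue_on ({0..1} \<times> {0..1}))"
    and cont: "\<And>t s. t \<in> {0..1} \<Longrightarrow> s \<in> {0..1} \<Longrightarrow> ((\<lambda>t'. k t' s) \<longlongrightarrow> k t s) (at t within {0..1})"
    and t: "t \<in> {0..1}"
  shows "k t \<in> borel_measurable (lebesgue_on {0..1})"
proof -
  define g where "g = (\<lambda>p. if p \<in> {0..1} \<times> {0..1} then k (fst p) (snd p) else 0)"
  have sq: "{0..1::real} \<times> {0..1::real} \<in> sets lebesgue"
    by (metis cbox_Pair_eq cbox_interval lmeasurable_cbox fmeasurableD)
  have "g \<in> borel_measurable lebesgue"
    unfolding g_def using meas sq by (subst borel_measurable_if) auto
  then have "AE t in lborel. (\<lambda>s. g (t, s)) \<in> borel_measurable lebesgue"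
    by (rule AE_section_lebesgue_measurable)
  moreover have "k t \<in> borel_measurable (lebesgue_on {0..1})"
    if "(\<lambda>s. g (t, s)) \<in> borel_measurable lebesgue" "t \<in> {0..1}" for t
  proof -
    have "(\<lambda>s. g (t, s)) = (\<lambda>s. if s \<in> {0..1} then k t s else 0)"
      using that by (auto simp: g_def)
    then show ?thesis using that by (simp add: borel_measurable_if del: atLeastAtMost_iff)
  qed
  ultimately have good: "AE t in lborel. t \<in> {0..1} \<longrightarrow> k t \<in> borel_measurable (lebesgue_on {0..1})"
    by (auto elim: eventually_mono)
  have near: "\<exists>t'\<in>{0..1}. t' \<noteq> t \<and> \<bar>t' - t\<bar> < e \<and> k t' \<in> borel_measurable (lebesgue_on {0..1})"
    if e: "0 < e" for e
  proof -
    \<comment> \<open>Clipping to [0,1] leaves an interval of positive length even when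
      \<open>t\<close> is an endpoint. The approximating point must differ from \<open>t\<close>,
      because the limit along \<open>at t within {0..1}\<close> ignores \<open>t\<close>
      itself.\<close>
    define lo hi where "lo = max 0 (t - e)" and "hi = min 1 (t + e)"
    have lohi: "lo < hi" using t e by (auto simp: lo_def hi_def)
    have "\<exists>t'. t' \<in> {lo<..<hi} \<and> t' \<noteq> t \<and> (t' \<in> {0..1} \<longrightarrow> k t' \<in> borel_measurable (lebesgue_on {0..1}))"
    proof (rule ccontr)
      assume contr: "\<not> ?thesis"
      have "AE t' in lborel. t' \<noteq> t" by (rule AE_lborel_singleton)
      with good have "AE t' in lborel. t' \<notin> {lo<..<hi}"
        by eventually_elim (use contr in auto)
      then have "emeasure lborel {lo<..<hi} = 0"
        by (subst (asm) AE_iff_measurable[where N = "{lo<..<hi}"]) auto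
      then show False using lohi by simp
    qed
    then show ?thesis by (auto simp: lo_def hi_def)
  qed
  then have "\<forall>n::nat. \<exists>t'. t' \<in> {0..1} \<and> t' \<noteq> t \<and> \<bar>t' - t\<bar> < 1 / real (Suc n) \<and>
      k t' \<in> borel_measurable (lebesgue_on {0..1})"
    by (simp add: Bex_def)
  then obtain X where X: "\<And>n. X n \<in> {0..1}" "\<And>n. X n \<noteq> t" "\<And>n. \<bar>X n - t\<bar> < 1 / real (Suc n)"
      "\<And>n. k (X n) \<in> borel_measurable (lebesgue_on {0..1})"
    unfolding choice_iff by blast
  have "(\<lambda>n. X n - t) \<longlonglongrightarrow> 0"
    by (rule Lim_null_comparison[OF _ LIMSEQ_Suc[OF lim_1_over_n]])
       (use X(3) in \<open>auto intro!: always_eventually less_imp_le\<close>)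
  then have "X \<longlonglongrightarrow> t" by (simp add: LIM_zero_iff)
  then have "filterlim X (at t within {0..1}) sequentially"
    using X by (auto simp: filterlim_at)
  then have "(\<lambda>n. k (X n) s) \<longlonglongrightarrow> k t s" if "s \<in> {0..1}" for s
    by (rule filterlim_compose[OF cont[OF t that]])
  then show ?thesis
    by (rule borel_measurable_LIMSEQ_real[OF _ X(4)]) simp
qed

section \<open>The integral operator\<close>

text \<open>All that the integral estimates ask of a component \<open>w\<close>; it keeps them
  independent of the cone and makes their constants depend on \<open>r\<close> alone.\<close>

definition nonneg_below :: "real \<Rightarrow> (real \<Rightarrow> real) \<Rightarrow> bool" where
  "nonneg_below r w \<longleftrightarrow> continuous_on {0..1} w \<and> (\<forall>t\<in>{0..1}. 0 \<le> w t \<and> w t \<le> r)"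

text \<open>A single equation of the system, so that the analysis is carried out once and
  instantiated for both indices.\<close>

locale hammerstein_kernel =
  fixes k :: "real \<Rightarrow> real \<Rightarrow> real" and f :: "real \<Rightarrow> real \<Rightarrow> real \<Rightarrow> real"
    and \<Phi> :: "real \<Rightarrow> real" and a b c :: real
  assumes f_nonneg: "\<And>t x y. t \<in> {0..1} \<Longrightarrow> 0 \<le> x \<Longrightarrow> 0 \<le> y \<Longrightarrow> 0 \<le> f t x y"
    and f_meas: "\<And>x y. 0 \<le> x \<Longrightarrow> 0 \<le> y \<Longrightarrow> (\<lambda>t. f t x y) \<in> borel_measurable (lebesgue_on {0..1})"
    and f_cont: "AE t in lebesgue_on {0..1}. continuous_on ({0..} \<times> {0..}) (\<lambda>p. f t (fst p) (snd p))"
    and f_bound: "\<And>r. r > 0 \<Longrightarrow> \<exists>\<phi>\<in>Linf.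
        AE t in lebesgue_on {0..1}. \<forall>x\<in>{0<..<r}. \<forall>y\<in>{0<..<r}. f t x y \<le> \<phi> t"
    and k_nonneg: "\<And>t s. t \<in> {0..1} \<Longrightarrow> s \<in> {0..1} \<Longrightarrow> 0 \<le> k t s"
    and k_meas: "(\<lambda>p. k (fst p) (snd p)) \<in> borel_measurable (lebesgue_on ({0..1} \<times> {0..1}))"
    and k_cont: "\<And>t s. t \<in> {0..1} \<Longrightarrow> s \<in> {0..1} \<Longrightarrow>
        ((\<lambda>t'. \<bar>k t' s - k t s\<bar>) \<longlongrightarrow> 0) (at t within {0..1})"
    and ab: "0 \<le> a" "a \<le> b" "b \<le> 1"
    and \<Phi>_Linf: "\<Phi> \<in> Linf"
    and c: "0 < c"
    and k_upper: "\<And>t. t \<in> {0..1} \<Longrightarrow> AE s in lebesgue_on {0..1}. k t s \<le> \<Phi> s"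
    and k_lower: "\<And>t. t \<in> {a..b} \<Longrightarrow> AE s in lebesgue_on {0..1}. c * \<Phi> s \<le> k t s"
begin

abbreviation "L01 \<equiv> lebesgue_on {0..1::real}"

definition integral_op :: "(real \<Rightarrow> real) \<Rightarrow> (real \<Rightarrow> real) \<Rightarrow> real \<Rightarrow> real" where
  "integral_op u v t = (\<integral>s. k t s * f s (u s) (v s) \<partial>L01)"

sublocale L01: finite_measure L01
  by (rule finite_measure_lebesgue_on) simp

section \<open>The kernel as a continuous curve in L^1\<close>

lemma k_tendsto: "t \<in> {0..1} \<Longrightarrow> s \<in> {0..1} \<Longrightarrow> ((\<lambda>t'. k t' s) \<longlongrightarrow> k t s) (at t within {0..1})"
  using k_cont[of t s] by (simp add: tendsto_rabs_zero_iff LIM_zero_iff)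

lemma k_section_meas: "t \<in> {0..1} \<Longrightarrow> k t \<in> borel_measurable L01"
  by (rule kernel_section_measurable[OF k_meas k_tendsto])

text \<open>The bound \<open>B\<close> is uniform in \<open>t\<close>, although the exceptional null
  set may vary with \<open>t\<close>. This is harmless, because every later estimate integrates in
  \<open>s\<close> at fixed values of \<open>t\<close>.\<close>

lemma k_bounded: "\<exists>B\<ge>0. \<forall>t\<in>{0..1}. AE s in L01. 0 \<le> k t s \<and> k t s \<le> B"
proof -
  obtain B where B: "AE t in L01. \<bar>\<Phi> t\<bar> \<le> B" using \<Phi>_Linf by (auto simp: Linf_def)
  have "AE s in L01. 0 \<le> k t s \<and> k t s \<le> max 0 B" if t: "t \<in> {0..1}" for t
    using B k_upper[OF t] AE_space by eventually_elim (use k_nonneg t in auto)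
  then show ?thesis by (intro exI[of _ "max 0 B"]) auto
qed

lemma k_integrable: "t \<in> {0..1} \<Longrightarrow> integrable L01 (k t)"
proof -
  assume t: "t \<in> {0..1}"
  obtain B where B: "\<And>t. t \<in> {0..1} \<Longrightarrow> AE s in L01. 0 \<le> k t s \<and> k t s \<le> B" using k_bounded by blast
  show ?thesis
  proof (rule L01.integrable_const_bound[of _ B])
    show "AE s in L01. norm (k t s) \<le> B" using B[OF t] by eventually_elim auto
  qed (rule k_section_meas[OF t])
qed

text \<open>Both sections lie in \<open>[0, B]\<close> almost everywhere, so dominated convergence
  upgrades pointwise continuity in \<open>t\<close> to continuity in L^1. The resulting modulus is
  what makes the images of the operator equicontinuous.\<close>

lemma k_L1_continuous:
  assumes t: "t \<in> {0..1}"
  shows "((\<lambda>t'. \<integral>s. \<bar>k t' s - k t s\<bar> \<partial>L01) \<longlongrightarrow> 0) (at t within {0..1})"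
  unfolding tendsto_at_iff_sequentially
proof (intro allI impI)
  fix X assume X: "\<forall>i. X i \<in> {0..1} - {t}" and lim: "X \<longlonglongrightarrow> t"
  have flim: "filterlim X (at t within {0..1}) sequentially"
    using X lim by (auto simp: filterlim_at)
  obtain B where B: "\<And>t. t \<in> {0..1} \<Longrightarrow> AE s in L01. 0 \<le> k t s \<and> k t s \<le> B" using k_bounded by blast
  have "(\<lambda>n. \<integral>s. \<bar>k (X n) s - k t s\<bar> \<partial>L01) \<longlonglongrightarrow> (\<integral>s. 0 \<partial>L01)"
  proof (rule integral_dominated_convergence[where w = "\<lambda>_. B"])
    have [measurable]: "k (X n) \<in> borel_measurable L01" for n using X by (intro k_section_meas) auto
    have [measurable]: "k t \<in> borel_measurable L01" using t by (rule k_section_meas)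
    show "(\<lambda>s. \<bar>k (X n) s - k t s\<bar>) \<in> borel_measurable L01" for n by measurable
    show "AE s in L01. (\<lambda>n. \<bar>k (X n) s - k t s\<bar>) \<longlonglongrightarrow> 0"
      using AE_space by eventually_elim (use filterlim_compose[OF k_cont[OF t] flim] in auto)
    show "AE s in L01. norm \<bar>k (X n) s - k t s\<bar> \<le> B" for n
    proof -
      have "X n \<in> {0..1}" using X by blast
      from B[OF t] B[OF this] show ?thesis by eventually_elim auto
    qed
  qed auto
  then show "((\<lambda>t'. \<integral>s. \<bar>k t' s - k t s\<bar> \<partial>L01) \<circ> X) \<longlonglongrightarrow> 0" by (simp add: o_def)
qed

text \<open>The hypothesis controls \<open>f\<close> on open squares only, while functions in the
  cone may take the value 0 and reach \<open>r\<close>. It is applied with radius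
  \<open>r + 1\<close>, each point is approached diagonally from inside, and continuity for almost
  every \<open>s\<close> carries the bound to the closed square.\<close>

lemma f_unif_bound:
  assumes "0 < r"
  shows "\<exists>M\<ge>0. AE s in L01. \<forall>x\<in>{0..r}. \<forall>y\<in>{0..r}. f s x y \<le> M"
proof -
  have "0 < r + 1" using assms by simp
  from f_bound[OF this] obtain \<phi> where \<phi>: "\<phi> \<in> Linf"
    and ae: "AE t in L01. \<forall>x\<in>{0<..<r+1}. \<forall>y\<in>{0<..<r+1}. f t x y \<le> \<phi> t" by blast
  obtain M where M: "AE t in L01. \<bar>\<phi> t\<bar> \<le> M" using \<phi> by (auto simp: Linf_def)
  have "AE s in L01. \<forall>x\<in>{0..r}. \<forall>y\<in>{0..r}. f s x y \<le> max 0 M"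
    using ae M f_cont
  proof eventually_elim
    case (elim s)
    show ?case
    proof (intro ballI)
      fix x y assume xy: "x \<in> {0..r}" "y \<in> {0..r}"
      \<comment> \<open>Starting at 1/2 rather than 1 keeps \<open>x + d n\<close> strictly below
        \<open>r + 1\<close> even for \<open>x = r\<close>.\<close>
      define d where "d = (\<lambda>n. 1 / real (Suc (Suc n)))"
      have d: "0 < d n" "d n < 1" for n by (auto simp: d_def)
      have "d \<longlonglongrightarrow> 0" unfolding d_def by (intro LIMSEQ_Suc lim_1_over_n)
      then have "(\<lambda>n. f s (x + d n) (y + d n)) \<longlonglongrightarrow> f s x y"
        using xy less_imp_le[OF d(1)] tendsto_add[OF tendsto_const[of x] \<open>d \<longlonglongrightarrow> 0\<close>]
          tendsto_add[OF tendsto_const[of y] \<open>d \<longlonglongrightarrow> 0\<close>]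
        by (intro continuous_on_quadrant_tendsto[OF elim(3)]) (simp_all add: add_nonneg_nonneg)
      moreover have "f s (x + d n) (y + d n) \<le> max 0 M" for n
      proof -
        have "x + d n \<in> {0<..<r+1}" "y + d n \<in> {0<..<r+1}" using xy d[of n] by auto
        then have "f s (x + d n) (y + d n) \<le> \<phi> s" using elim(1) by blast
        then show ?thesis using elim(2) by linarith
      qed
      ultimately show "f s x y \<le> max 0 M" by (auto intro: LIMSEQ_le_const2)
    qed
  qed
  then show ?thesis by (intro exI[of _ "max 0 M"]) auto
qed

lemma f_comp_meas:
  assumes "nonneg_below r u" "nonneg_below r v"
  shows "(\<lambda>s. f s (u s) (v s)) \<in> borel_measurable L01"
proof -
  have w: "w \<in> borel_measurable L01" if "nonneg_below r w" for w
    using that by (simp add: nonneg_below_def continuous_imp_measurable_on_sets_lebesgue)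
  show ?thesis
  proof (rule caratheodory_measurable[OF _ _ f_cont w[OF assms(1)] _ w[OF assms(2)]])
    show "(\<lambda>t. f t x y) \<in> borel_measurable L01" if "0 \<le> x" "0 \<le> y" for x y
      using that by (rule f_meas)
  qed (use assms in \<open>auto simp: nonneg_below_def\<close>)
qed

lemma f_comp_bound:
  assumes r: "0 < r"
  shows "\<exists>M\<ge>0. \<forall>u v. nonneg_below r u \<longrightarrow> nonneg_below r v \<longrightarrow> (AE s in L01. 0 \<le> f s (u s) (v s) \<and> f s (u s) (v s) \<le> M)"
proof -
  obtain M where M: "M \<ge> 0" "AE s in L01. \<forall>x\<in>{0..r}. \<forall>y\<in>{0..r}. f s x y \<le> M"
    using f_unif_bound[OF r] by blast
  have "AE s in L01. 0 \<le> f s (u s) (v s) \<and> f s (u s) (v s) \<le> M" if "nonneg_below r u" "nonneg_below r v" for u v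
    using M(2) AE_space
    by eventually_elim (use that f_nonneg in \<open>auto simp: nonneg_below_def\<close>)
  with M(1) show ?thesis by blast
qed

lemma integrable_kf:
  assumes r: "0 < r" and uv: "nonneg_below r u" "nonneg_below r v" and t: "t \<in> {0..1}"
  shows "integrable L01 (\<lambda>s. k t s * f s (u s) (v s))"
proof -
  obtain M where M: "M \<ge> 0" "AE s in L01. 0 \<le> f s (u s) (v s) \<and> f s (u s) (v s) \<le> M"
    using f_comp_bound[OF r] uv by blast
  obtain B where B: "B \<ge> 0" "AE s in L01. 0 \<le> k t s \<and> k t s \<le> B" using k_bounded t by blast
  show ?thesis
  proof (rule L01.integrable_const_bound[of _ "B * M"])
    show "AE s in L01. norm (k t s * f s (u s) (v s)) \<le> B * M"
      using M(2) B(2) by eventually_elim (auto simp: abs_mult intro!: mult_mono B(1))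
  qed (intro borel_measurable_times k_section_meas f_comp_meas[OF uv] t)
qed

section \<open>Estimates for the integral operator\<close>

lemma integral_op_nonneg:
  assumes uv: "nonneg_below r u" "nonneg_below r v" and t: "t \<in> {0..1}"
  shows "0 \<le> integral_op u v t"
  unfolding integral_op_def
  by (rule integral_nonneg_AE, rule AE_I2)
     (use uv t k_nonneg f_nonneg in \<open>auto simp: nonneg_below_def intro!: mult_nonneg_nonneg\<close>)

lemma integral_op_bounded:
  assumes r: "0 < r"
  shows "\<exists>M\<ge>0. \<forall>u v. nonneg_below r u \<longrightarrow> nonneg_below r v \<longrightarrow> (\<forall>t\<in>{0..1}. integral_op u v t \<le> M)"
proof -
  obtain M where M: "M \<ge> 0" "\<And>u v. nonneg_below r u \<Longrightarrow> nonneg_below r v \<Longrightarrow> AE s in L01. 0 \<le> f s (u s) (v s) \<and> f s (u s) (v s) \<le> M"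
    using f_comp_bound[OF r] by blast
  obtain B where B: "B \<ge> 0" "\<And>t. t \<in> {0..1} \<Longrightarrow> AE s in L01. 0 \<le> k t s \<and> k t s \<le> B"
    using k_bounded by blast
  have "integral_op u v t \<le> B * M" if uv: "nonneg_below r u" "nonneg_below r v" and t: "t \<in> {0..1}" for u v t
  proof -
    have "AE s in L01. k t s * f s (u s) (v s) \<le> B * M"
      using M(2)[OF uv] B(2)[OF t] by eventually_elim (auto intro!: mult_mono B(1))
    then have "integral_op u v t \<le> (\<integral>s. B * M \<partial>L01)"
      unfolding integral_op_def by (intro integral_mono_AE integrable_kf[OF r uv t]) auto
    then show ?thesis by (simp add: measure_restrict_space)
  qed
  then show ?thesis using M(1) B(1) by (intro exI[of _ "B * M"]) auto
qed

text \<open>The nonlinearity enters only through its uniform bound \<open>M\<close>; the dependence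
  on \<open>t\<close> is left to the kernel, so the modulus is the same for all \<open>u\<close> and
  \<open>v\<close>.\<close>

lemma integral_op_equicont:
  assumes r: "0 < r"
  shows "\<exists>M\<ge>0. \<forall>u v. nonneg_below r u \<longrightarrow> nonneg_below r v \<longrightarrow>
    (\<forall>t\<in>{0..1}. \<forall>t'\<in>{0..1}. \<bar>integral_op u v t' - integral_op u v t\<bar> \<le> M * (\<integral>s. \<bar>k t' s - k t s\<bar> \<partial>L01))"
proof -
  obtain M where M: "M \<ge> 0" "\<And>u v. nonneg_below r u \<Longrightarrow> nonneg_below r v \<Longrightarrow> AE s in L01. 0 \<le> f s (u s) (v s) \<and> f s (u s) (v s) \<le> M"
    using f_comp_bound[OF r] by blast
  have "\<bar>integral_op u v t' - integral_op u v t\<bar> \<le> M * (\<integral>s. \<bar>k t' s - k t s\<bar> \<partial>L01)"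
    if uv: "nonneg_below r u" "nonneg_below r v" and t: "t \<in> {0..1}" "t' \<in> {0..1}" for u v t t'
  proof -
    note int = integrable_kf[OF r uv]
    have eq: "integral_op u v t' - integral_op u v t =
        (\<integral>s. k t' s * f s (u s) (v s) - k t s * f s (u s) (v s) \<partial>L01)"
      unfolding integral_op_def by (rule Bochner_Integration.integral_diff[symmetric]) (use int t in auto)
    have "\<bar>integral_op u v t' - integral_op u v t\<bar> \<le> (\<integral>s. \<bar>k t' s * f s (u s) (v s) - k t s * f s (u s) (v s)\<bar> \<partial>L01)"
      unfolding eq by (rule integral_abs_bound)
    also have "\<dots> \<le> (\<integral>s. M * \<bar>k t' s - k t s\<bar> \<partial>L01)"
    proof (rule integral_mono_AE)
      show "AE s in L01. \<bar>k t' s * f s (u s) (v s) - k t s * f s (u s) (v s)\<bar> \<le> M * \<bar>k t' s - k t s\<bar>"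
        using M(2)[OF uv]
      proof eventually_elim
        case (elim s)
        have "\<bar>k t' s * f s (u s) (v s) - k t s * f s (u s) (v s)\<bar> = f s (u s) (v s) * \<bar>k t' s - k t s\<bar>"
          by (metis abs_mult abs_of_nonneg elim(1) left_diff_distrib mult.commute)
        then show ?case using elim by (simp add: mult_right_mono)
      qed
    qed (use int[OF t(1)] int[OF t(2)] k_integrable[OF t(1)] k_integrable[OF t(2)] in auto)
    finally show ?thesis by simp
  qed
  with M(1) show ?thesis by blast
qed

text \<open>The chain \<open>c * k t' s \<le> c * \<Phi> s \<le> k t s\<close>, integrated against
  the nonnegative values of \<open>f\<close>, is the source of the cone inequality.\<close>

lemma integral_op_lower:
  assumes r: "0 < r" and uv: "nonneg_below r u" "nonneg_below r v" and t: "t \<in> {a..b}" and t': "t' \<in> {0..1}"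
  shows "c * integral_op u v t' \<le> integral_op u v t"
proof -
  have t01: "t \<in> {0..1}" using t ab by auto
  have "AE s in L01. c * (k t' s * f s (u s) (v s)) \<le> k t s * f s (u s) (v s)"
    using k_upper[OF t'] k_lower[OF t] AE_space
  proof eventually_elim
    case (elim s)
    then have "c * k t' s \<le> k t s" using c by (meson mult_le_cancel_left_pos order_trans)
    moreover have "0 \<le> f s (u s) (v s)" using elim uv f_nonneg by (auto simp: nonneg_below_def)
    ultimately show ?case by (metis mult.assoc mult_right_mono)
  qed
  then have "(\<integral>s. c * (k t' s * f s (u s) (v s)) \<partial>L01) \<le> integral_op u v t"
    unfolding integral_op_def
    by (intro integral_mono_AE integrable_kf[OF r uv t01] integrable_mult_right integrable_kf[OF r uv t'])
  then show ?thesis by (simp add: integral_op_def)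
qed

text \<open>Dominated convergence handles the composition with \<open>f\<close>, so pointwise
  convergence of the arguments is enough. The kernel contributes the constant factor
  \<open>B\<close>, which is why the error \<open>\<delta> n\<close> is uniform in
  \<open>t\<close>.\<close>

lemma integral_op_converges:
  assumes r: "0 < r" and UV: "\<And>n. nonneg_below r (U n)" "\<And>n. nonneg_below r (V n)" and uv: "nonneg_below r u" "nonneg_below r v"
    and lim: "\<And>s. s \<in> {0..1} \<Longrightarrow> (\<lambda>n. U n s) \<longlonglongrightarrow> u s" "\<And>s. s \<in> {0..1} \<Longrightarrow> (\<lambda>n. V n s) \<longlonglongrightarrow> v s"
  shows "\<exists>\<delta>. \<delta> \<longlonglongrightarrow> 0 \<and> (\<forall>n. \<forall>t\<in>{0..1}. \<bar>integral_op (U n) (V n) t - integral_op u v t\<bar> \<le> \<delta> n)"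
proof -
  obtain M where M: "M \<ge> 0" "\<And>u v. nonneg_below r u \<Longrightarrow> nonneg_below r v \<Longrightarrow> AE s in L01. 0 \<le> f s (u s) (v s) \<and> f s (u s) (v s) \<le> M"
    using f_comp_bound[OF r] by blast
  obtain B where B: "B \<ge> 0" "\<And>t. t \<in> {0..1} \<Longrightarrow> AE s in L01. 0 \<le> k t s \<and> k t s \<le> B"
    using k_bounded by blast
  define d where "d = (\<lambda>n s. \<bar>f s (U n s) (V n s) - f s (u s) (v s)\<bar>)"
  have [measurable]: "d n \<in> borel_measurable L01" for n
    unfolding d_def using f_comp_meas[OF UV] f_comp_meas[OF uv] by measurable
  have d_bound: "AE s in L01. norm (d n s) \<le> M" for n
    using M(2)[OF UV, of n n] M(2)[OF uv] by eventually_elim (auto simp: d_def)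
  have d_int: "integrable L01 (d n)" for n
    by (rule L01.integrable_const_bound[OF d_bound]) measurable
  have "(\<lambda>n. \<integral>s. d n s \<partial>L01) \<longlonglongrightarrow> (\<integral>s. 0 \<partial>L01)"
  proof (rule integral_dominated_convergence[where w = "\<lambda>_. M"])
    show "AE s in L01. (\<lambda>n. d n s) \<longlonglongrightarrow> 0"
      using f_cont AE_space
    proof eventually_elim
      case (elim s)
      then have s: "s \<in> {0..1}" by simp
      have "(\<lambda>n. f s (U n s) (V n s)) \<longlonglongrightarrow> f s (u s) (v s)"
        using UV s by (intro continuous_on_quadrant_tendsto[OF elim(1)] lim) (auto simp: nonneg_below_def)
      then show ?case by (simp add: d_def tendsto_rabs_zero_iff LIM_zero_iff)
    qed
  qed (use d_bound in auto)
  then have "(\<lambda>n. B * (\<integral>s. d n s \<partial>L01)) \<longlonglongrightarrow> 0"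
    using tendsto_mult_right_zero by auto
  moreover have "\<bar>integral_op (U n) (V n) t - integral_op u v t\<bar> \<le> B * (\<integral>s. d n s \<partial>L01)"
    if t: "t \<in> {0..1}" for n t
  proof -
    note int = integrable_kf[OF r UV(1)[of n] UV(2)[of n] t] integrable_kf[OF r uv t]
    have eq: "integral_op (U n) (V n) t - integral_op u v t =
        (\<integral>s. k t s * f s (U n s) (V n s) - k t s * f s (u s) (v s) \<partial>L01)"
      unfolding integral_op_def by (rule Bochner_Integration.integral_diff[symmetric]) (use int in auto)
    have "\<bar>integral_op (U n) (V n) t - integral_op u v t\<bar> \<le> (\<integral>s. \<bar>k t s * f s (U n s) (V n s) - k t s * f s (u s) (v s)\<bar> \<partial>L01)"
      unfolding eq by (rule integral_abs_bound)
    also have "\<dots> \<le> (\<integral>s. B * d n s \<partial>L01)"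
    proof (rule integral_mono_AE)
      show "AE s in L01. \<bar>k t s * f s (U n s) (V n s) - k t s * f s (u s) (v s)\<bar> \<le> B * d n s"
        using B(2)[OF t]
      proof eventually_elim
        case (elim s)
        have "\<bar>k t s * f s (U n s) (V n s) - k t s * f s (u s) (v s)\<bar> = k t s * d n s"
          by (metis abs_mult abs_of_nonneg elim d_def right_diff_distrib)
        then show ?case using elim by (simp add: d_def mult_right_mono)
      qed
    qed (use int d_int in auto)
    finally show ?thesis by simp
  qed
  ultimately show ?thesis by blast
qed

lemma integral_restrict_subinterval:
  fixes g :: "real \<Rightarrow> real"
  shows "integral\<^sup>L (lebesgue_on {a..b}) g = (\<integral>s. indicator {a..b} s * g s \<partial>L01)"
proof -
  have "(\<lambda>s. indicator {0..1} s *\<^sub>R (indicator {a..b} s * g s)) = (\<lambda>s. indicator {a..b} s *\<^sub>R g s)"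
    using ab by (auto simp: indicator_def)
  then show ?thesis by (simp only: integral_restrict_space sets.Int_space_eq2 lmeasurable_cbox fmeasurableD
        sets_completionI_sets sets_lborel borel_closed closed_atLeastAtMost)
qed

lemma integral_op_ge:
  assumes r: "0 < r" and uv: "nonneg_below r u" "nonneg_below r v" and t: "t \<in> {0..1}"
    and \<gamma>: "\<And>s. s \<in> {a..b} \<Longrightarrow> \<gamma> s \<le> f s (u s) (v s)"
  shows "integral\<^sup>L (lebesgue_on {a..b}) (\<lambda>s. k t s * \<gamma> s) \<le> integral_op u v t"
  unfolding integral_restrict_subinterval integral_op_def
\<comment> \<open>Integrability is checked only for the larger function: if the smaller one were not
  integrable, its integral would be 0 by convention, and the larger one is nonnegative.\<close>
proof (rule integral_mono_AE'[OF integrable_kf[OF r uv t]])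
  have nn: "0 \<le> k t s * f s (u s) (v s)" if "s \<in> {0..1}" for s
    using that k_nonneg[OF t] f_nonneg uv by (auto simp: nonneg_below_def intro!: mult_nonneg_nonneg)
  then show "AE s in L01. 0 \<le> k t s * f s (u s) (v s)" by (intro AE_I2) auto
  show "AE s in L01. indicator {a..b} s * (k t s * \<gamma> s) \<le> k t s * f s (u s) (v s)"
  proof (rule AE_I2)
    fix s assume "s \<in> space L01"
    then show "indicator {a..b} s * (k t s * \<gamma> s) \<le> k t s * f s (u s) (v s)"
      using nn[of s] \<gamma>[of s] k_nonneg[OF t, of s] by (cases "s \<in> {a..b}") (auto intro: mult_left_mono)
  qed
qed

end

section \<open>The cones and their realisation among bounded continuous functions\<close>

lemma abs_le_sup_norm:
  assumes "continuous_on {0..1} x" "t \<in> {0..1}"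
  shows "\<bar>x t\<bar> \<le> sup_norm x"
  unfolding sup_norm_def
proof (rule cSUP_upper[OF assms(2)])
  have "compact ((\<lambda>t. \<bar>x t\<bar>) ` {0..1})"
    using assms(1) by (intro compact_continuous_image continuous_intros) auto
  then show "bdd_above ((\<lambda>t. \<bar>x t\<bar>) ` {0..1})"
    by (intro bounded_imp_bdd_above compact_imp_bounded)
qed

lemma sup_norm_le: "(\<And>t. t \<in> {0..1} \<Longrightarrow> \<bar>x t\<bar> \<le> B) \<Longrightarrow> sup_norm x \<le> B"
  unfolding sup_norm_def by (rule cSUP_least) auto

lemma sup_norm_nonneg: "continuous_on {0..1} x \<Longrightarrow> 0 \<le> sup_norm x"
  using abs_le_sup_norm[of x 0] by simp

lemma sup_norm_add:
  assumes "continuous_on {0..1} x" "continuous_on {0..1} y"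
  shows "sup_norm (\<lambda>t. x t + y t) \<le> sup_norm x + sup_norm y"
proof (rule sup_norm_le)
  fix t :: real assume "t \<in> {0..1}"
  then show "\<bar>x t + y t\<bar> \<le> sup_norm x + sup_norm y"
    using abs_le_sup_norm[OF assms(1), of t] abs_le_sup_norm[OF assms(2), of t] by linarith
qed

lemma sup_norm_mono:
  assumes "continuous_on {0..1} y" "\<And>t. t \<in> {0..1} \<Longrightarrow> \<bar>x t\<bar> \<le> \<bar>y t\<bar>"
  shows "sup_norm x \<le> sup_norm y"
  using assms abs_le_sup_norm[OF assms(1)] by (intro sup_norm_le) (meson order_trans)

lemma sup_norm_scale:
  assumes "continuous_on {0..1} x" "0 \<le> c"
  shows "sup_norm (\<lambda>t. c * x t) = c * sup_norm x"
proof (cases "c = 0")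
  case True
  then show ?thesis by (simp add: sup_norm_def)
next
  case False
  then have c: "0 < c" using assms by simp
  have cx: "continuous_on {0..1} (\<lambda>t. c * x t)" using assms by (intro continuous_intros)
  show ?thesis
  proof (rule antisym)
    show "sup_norm (\<lambda>t. c * x t) \<le> c * sup_norm x"
      using c abs_le_sup_norm[OF assms(1)] by (intro sup_norm_le) (simp add: abs_mult)
    have "sup_norm x \<le> sup_norm (\<lambda>t. c * x t) / c"
      using c abs_le_sup_norm[OF cx] by (intro sup_norm_le) (simp add: abs_mult field_simps)
    then show "c * sup_norm x \<le> sup_norm (\<lambda>t. c * x t)"
      using c by (simp add: field_simps)
  qed
qed

text \<open>The infimum is a genuine lower bound because nonnegativity bounds the values below and
  \<open>a \<le> b\<close> makes the interval nonempty; it can therefore be replaced by pointwise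
  inequalities.\<close>

lemma cone_Qi_iff:
  assumes "0 \<le> a" "a \<le> b" "b \<le> 1"
  shows "x \<in> cone_Qi c a b \<longleftrightarrow> continuous_on {0..1} x \<and> (\<forall>t\<in>{0..1}. 0 \<le> x t) \<and>
    (\<forall>t\<in>{a..b}. c * sup_norm x \<le> x t)"
proof -
  have "(INF t\<in>{a..b}. x t) \<ge> c * sup_norm x \<longleftrightarrow> (\<forall>t\<in>{a..b}. c * sup_norm x \<le> x t)"
    if nn: "\<forall>t\<in>{0..1}. 0 \<le> x t"
  proof -
    have "bdd_below (x ` {a..b})" using nn assms by (intro bdd_belowI[of _ 0]) auto
    then show ?thesis using assms by (subst le_cINF_iff) auto
  qed
  then show ?thesis by (auto simp: cone_Qi_def C01_def)
qed

lemma cone_Qi_add: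
  assumes "0 \<le> a" "a \<le> b" "b \<le> 1" "0 \<le> c" and x: "x \<in> cone_Qi c a b" and y: "y \<in> cone_Qi c a b"
  shows "(\<lambda>t. x t + y t) \<in> cone_Qi c a b"
  unfolding cone_Qi_iff[OF assms(1-3)]
proof (intro conjI ballI)
  note xy = x[unfolded cone_Qi_iff[OF assms(1-3)]] y[unfolded cone_Qi_iff[OF assms(1-3)]]
  show "continuous_on {0..1} (\<lambda>t. x t + y t)" using xy by (intro continuous_intros) auto
  show "0 \<le> x t + y t" if "t \<in> {0..1}" for t using xy that by (intro add_nonneg_nonneg) auto
  fix t assume t: "t \<in> {a..b}"
  have "c * sup_norm (\<lambda>t. x t + y t) \<le> c * (sup_norm x + sup_norm y)"
    using xy assms(4) by (intro mult_left_mono sup_norm_add) auto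
  also have "\<dots> \<le> x t + y t" using xy t by (auto simp: distrib_left intro!: add_mono)
  finally show "c * sup_norm (\<lambda>t. x t + y t) \<le> x t + y t" .
qed

lemma cone_Qi_scale:
  assumes "0 \<le> a" "a \<le> b" "b \<le> 1" "0 \<le> r" and x: "x \<in> cone_Qi c a b"
  shows "(\<lambda>t. r * x t) \<in> cone_Qi c a b"
  unfolding cone_Qi_iff[OF assms(1-3)]
proof (intro conjI ballI)
  note x' = x[unfolded cone_Qi_iff[OF assms(1-3)]]
  show "continuous_on {0..1} (\<lambda>t. r * x t)" using x' by (intro continuous_intros) auto
  show "0 \<le> r * x t" if "t \<in> {0..1}" for t using x' that assms(4) by (intro mult_nonneg_nonneg) auto
  fix t assume t: "t \<in> {a..b}"
  have "c * sup_norm (\<lambda>t. r * x t) = r * (c * sup_norm x)"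
    using x' assms(4) by (simp add: sup_norm_scale)
  also have "\<dots> \<le> r * x t" using x' t assms(4) by (intro mult_left_mono) auto
  finally show "c * sup_norm (\<lambda>t. r * x t) \<le> r * x t" .
qed

lemma cone_Qi_cong:
  assumes "0 \<le> a" "a \<le> b" "b \<le> 1" and eq: "\<And>t. t \<in> {0..1} \<Longrightarrow> x t = y t"
  shows "x \<in> cone_Qi c a b \<longleftrightarrow> y \<in> cone_Qi c a b"
proof -
  have "sup_norm x = sup_norm y" unfolding sup_norm_def using eq by (intro SUP_cong) auto
  moreover have "continuous_on {0..1} x \<longleftrightarrow> continuous_on {0..1} y" using eq by (rule continuous_on_cong[OF refl])
  moreover have "x t = y t" if "t \<in> {a..b}" for t using that eq assms by auto
  ultimately show ?thesis unfolding cone_Qi_iff[OF assms(1-3)] using eq by auto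
qed

section \<open>Bounded continuous functions on the line as a normed model of C[0,1]\<close>

lemma continuous_on_bcontfun_apply:
  "continuous_on S (\<lambda>x :: 'a::topological_space \<Rightarrow>\<^sub>C 'b::metric_space. apply_bcontfun x t)"
  by (rule lipschitz_on_continuous_on[of 1], rule lipschitz_onI) (auto simp: dist_bounded)

lemma continuous_on_bcontfun_sup_norm:
  "continuous_on S (\<lambda>x :: real \<Rightarrow>\<^sub>C real. sup_norm (apply_bcontfun x))"
proof (rule lipschitz_on_continuous_on[of 1], rule lipschitz_onI)
  fix x y :: "real \<Rightarrow>\<^sub>C real"
  have "sup_norm (apply_bcontfun x) \<le> sup_norm (apply_bcontfun y) + dist x y" for x y :: "real \<Rightarrow>\<^sub>C real"
  proof (rule sup_norm_le)
    fix t :: real assume "t \<in> {0..1}"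
    then have "\<bar>apply_bcontfun y t\<bar> \<le> sup_norm (apply_bcontfun y)"
      by (intro abs_le_sup_norm) auto
    moreover have "\<bar>apply_bcontfun x t - apply_bcontfun y t\<bar> \<le> dist x y"
      using dist_bounded[of x t y] by (simp add: dist_real_def)
    ultimately show "\<bar>apply_bcontfun x t\<bar> \<le> sup_norm (apply_bcontfun y) + dist x y" by linarith
  qed
  from this[of x y] this[of y x]
  show "dist (sup_norm (apply_bcontfun x)) (sup_norm (apply_bcontfun y)) \<le> 1 * dist x y"
    by (simp add: dist_real_def dist_commute abs_le_iff)
qed simp

text \<open>Evaluation and the supremum over [0,1] are 1-Lipschitz, so the cone is cut out by closed
  conditions. This keeps the closure of the image of the operator inside the cone.\<close>

lemma closed_bcontfun_cone_Qi:
  assumes "0 \<le> a" "a \<le> b" "b \<le> 1"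
  shows "closed {x. apply_bcontfun x \<in> cone_Qi c a b}"
proof -
  have "{x. apply_bcontfun x \<in> cone_Qi c a b} = (\<Inter>t\<in>{0..1}. {x. 0 \<le> apply_bcontfun x t}) \<inter>
      (\<Inter>t\<in>{a..b}. {x. c * sup_norm (apply_bcontfun x) \<le> apply_bcontfun x t})"
    by (auto simp: cone_Qi_iff[OF assms])
  also have "closed \<dots>"
    by (intro closed_Int closed_INT ballI closed_Collect_le continuous_on_bcontfun_apply
        continuous_intros continuous_on_bcontfun_sup_norm)
  finally show ?thesis .
qed

text \<open>Continuation by constants beyond the endpoints: \<open>clamp 0 1\<close> projects the
  line onto [0,1]. Distances between two continuations are decided on [0,1], so uniform convergence
  there is convergence in norm.\<close>

definition bc01 :: "(real \<Rightarrow> real) \<Rightarrow> real \<Rightarrow>\<^sub>C real" where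
  "bc01 x = Bcontfun (\<lambda>t. x (clamp 0 1 t))"

lemma clamp01_in [simp]: "clamp 0 1 t \<in> {0..1::real}"
  using clamp_in_interval[of 0 1 t] by simp

lemma bc01_apply:
  assumes "continuous_on {0..1} x"
  shows "apply_bcontfun (bc01 x) t = x (clamp 0 1 t)"
proof -
  obtain g :: "real \<Rightarrow>\<^sub>C real" where "\<And>t. g t = x (clamp 0 1 t)"
    using continuous_on_cbox_bcontfunE[of 0 1 x] assms by auto
  then have "(\<lambda>t. x (clamp 0 1 t)) = apply_bcontfun g" by auto
  then show ?thesis by (metis apply_bcontfun_inverse bc01_def)
qed

lemma bc01_apply_01 [simp]:
  assumes "continuous_on {0..1} x" "t \<in> {0..1}"
  shows "apply_bcontfun (bc01 x) t = x t"
  using assms clamp_cancel_cbox[of t 0 1] by (simp add: bc01_apply)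

lemma sup_norm_bc01: "continuous_on {0..1} x \<Longrightarrow> sup_norm (apply_bcontfun (bc01 x)) = sup_norm x"
  unfolding sup_norm_def by (intro SUP_cong) auto

lemma bc01_tendsto:
  assumes X: "\<And>n. continuous_on {0..1} (X n)" "continuous_on {0..1} x" and \<delta>: "\<delta> \<longlonglongrightarrow> 0"
    and le: "\<And>n t. t \<in> {0..1} \<Longrightarrow> \<bar>X n t - x t\<bar> \<le> \<delta> n"
  shows "(\<lambda>n. bc01 (X n)) \<longlonglongrightarrow> bc01 x"
proof (rule metric_tendsto_imp_tendsto[OF \<delta>], rule always_eventually, rule allI)
  fix n
  have "dist (bc01 (X n)) (bc01 x) \<le> \<delta> n"
    using le[OF clamp01_in, of n] X by (intro dist_bound) (simp add: bc01_apply dist_real_def)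
  then show "dist (bc01 (X n)) (bc01 x) \<le> dist (\<delta> n) 0" by simp
qed

text \<open>A sequence in the closure is shadowed by one in \<open>A\<close> at distances tending to
  0, and both have the same subsequential limits.\<close>

lemma compact_closure_sequential:
  fixes A :: "'a::metric_space set"
  assumes "\<And>y. \<forall>n::nat. y n \<in> A \<Longrightarrow> \<exists>l k. strict_mono k \<and> (y \<circ> k) \<longlonglongrightarrow> l"
  shows "compact (closure A)"
  unfolding compact_eq_seq_compact_metric
proof (rule seq_compactI)
  fix z :: "nat \<Rightarrow> 'a" assume z: "\<forall>n. z n \<in> closure A"
  have "\<exists>y\<in>A. dist y (z n) < 1 / real (Suc n)" for n
    using z closure_approachable[of "z n" A] by simp
  then have "\<forall>n. \<exists>y. y \<in> A \<and> dist y (z n) < 1 / real (Suc n)" by (simp add: Bex_def)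
  then obtain y where y: "\<And>n. y n \<in> A" "\<And>n. dist (y n) (z n) < 1 / real (Suc n)"
    unfolding choice_iff by blast
  obtain l k where k: "strict_mono k" and l: "(y \<circ> k) \<longlonglongrightarrow> l" using assms y(1) by blast
  have "(\<lambda>n. dist (y n) (z n)) \<longlonglongrightarrow> 0"
    by (rule Lim_null_comparison[OF _ LIMSEQ_Suc[OF lim_1_over_n]])
       (use y(2) in \<open>auto intro!: always_eventually less_imp_le\<close>)
  from LIMSEQ_subseq_LIMSEQ[OF this k] have yz: "(\<lambda>n. dist (y (k n)) (z (k n))) \<longlonglongrightarrow> 0" by (simp add: o_def)
  have yl: "(\<lambda>n. dist (y (k n)) l) \<longlonglongrightarrow> 0"
    using l by (subst (asm) tendsto_dist_iff) (simp add: o_def)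
  have s: "(\<lambda>n. dist (y (k n)) (z (k n)) + dist (y (k n)) l) \<longlonglongrightarrow> 0"
    using tendsto_add[OF yz yl] by simp
  have "(\<lambda>n. dist (z (k n)) l) \<longlonglongrightarrow> 0"
    by (rule Lim_null_comparison[OF _ s], rule always_eventually)
       (simp add: dist_triangle3)
  then have "(z \<circ> k) \<longlonglongrightarrow> l" by (subst tendsto_dist_iff) (simp add: o_def)
  moreover have "l \<in> closure A"
    using closed_sequentially[OF closed_closure _ l] y(1) closure_subset by (metis comp_apply subsetD)
  ultimately show "\<exists>l\<in>closure A. \<exists>k. strict_mono k \<and> (z \<circ> k) \<longlonglongrightarrow> l" using k by blast
qed

text \<open>Arzela-Ascoli on [0,1], transported by the constant continuation, which turns the
  uniform limit on [0,1] into a limit in norm.\<close>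

lemma compact_closure_bc01:
  assumes cont: "\<And>x. x \<in> A \<Longrightarrow> continuous_on {0..1} x"
    and bound: "\<And>x t. x \<in> A \<Longrightarrow> t \<in> {0..1} \<Longrightarrow> \<bar>x t\<bar> \<le> M"
    and equi: "\<And>t e. t \<in> {0..1} \<Longrightarrow> 0 < e \<Longrightarrow>
        \<exists>d>0. \<forall>x\<in>A. \<forall>t'\<in>{0..1}. \<bar>t' - t\<bar> < d \<longrightarrow> \<bar>x t' - x t\<bar> < e"
  shows "compact (closure (bc01 ` A))"
proof (rule compact_closure_sequential)
  fix y :: "nat \<Rightarrow> real \<Rightarrow>\<^sub>C real" assume "\<forall>n. y n \<in> bc01 ` A"
  then have "\<forall>n. \<exists>x. x \<in> A \<and> y n = bc01 x" by blast
  then obtain x where x: "\<And>n. x n \<in> A" and y: "\<And>n. y n = bc01 (x n)" unfolding choice_iff by blast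
  obtain g k where g: "continuous_on {0..1} g" and k: "strict_mono (k :: nat \<Rightarrow> nat)"
    and lim: "\<And>e. 0 < e \<Longrightarrow> \<exists>N. \<forall>n t. n \<ge> N \<and> t \<in> {0..1} \<longrightarrow> norm (x (k n) t - g t) < e"
  proof (rule Arzela_Ascoli[of "{0..1::real}" x M])
    show "norm (x n t) \<le> M" if "t \<in> {0..1}" for n t using bound[OF x that] by simp
    fix t e :: real assume "t \<in> {0..1}" "0 < e"
    from equi[OF this] obtain d where d: "d > 0" "\<And>z t'. z \<in> A \<Longrightarrow> t' \<in> {0..1} \<Longrightarrow> \<bar>t' - t\<bar> < d \<Longrightarrow> \<bar>z t' - z t\<bar> < e"
      by blast
    show "\<exists>d>0. \<forall>n t'. t' \<in> {0..1} \<and> norm (t - t') < d \<longrightarrow> norm (x n t - x n t') < e"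
      using d(1) d(2)[OF x] by (intro exI[of _ d]) (auto simp: abs_minus_commute)
  qed auto
  have "(y \<circ> k) \<longlonglongrightarrow> bc01 g"
  proof (rule metric_LIMSEQ_I)
    fix e :: real assume e: "0 < e"
    \<comment> \<open>Half of \<open>e\<close>, because a strict bound at every point gives only a
      non-strict bound for the supremum.\<close>
    then obtain N where N: "\<And>n t. n \<ge> N \<Longrightarrow> t \<in> {0..1} \<Longrightarrow> norm (x (k n) t - g t) < e / 2"
      using lim[of "e / 2"] by auto
    have "dist ((y \<circ> k) n) (bc01 g) < e" if "n \<ge> N" for n
    proof -
      have "dist ((y \<circ> k) n) (bc01 g) \<le> e / 2"
        using N[OF that clamp01_in] g cont[OF x]
        by (intro dist_bound) (simp add: y bc01_apply dist_real_def less_imp_le)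
      then show ?thesis using e by simp
    qed
    then show "\<exists>N. \<forall>n\<ge>N. dist ((y \<circ> k) n) (bc01 g) < e" by blast
  qed
  with k show "\<exists>l k. strict_mono k \<and> (y \<circ> k) \<longlonglongrightarrow> l" by blast
qed

section \<open>One component of the Hammerstein operator\<close>

lemma sup_norm_le_normY: "sup_norm (fst u) \<le> normY u" "sup_norm (snd u) \<le> normY u"
  by (auto simp: normY_def)

lemma compact_functional_tendsto:
  assumes H: "compact_functional Q H" and X: "\<And>n. X n \<in> Q" and x: "x \<in> Q"
    and lim: "(\<lambda>n. normY (\<lambda>t. fst (X n) t - fst x t, \<lambda>t. snd (X n) t - snd x t)) \<longlonglongrightarrow> 0"
  shows "(\<lambda>n. H (X n)) \<longlonglongrightarrow> H x"
proof (rule LIMSEQ_I)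
  fix e :: real assume "0 < e"
  then obtain d where d: "d > 0" "\<And>v. v \<in> Q \<Longrightarrow>
      normY (\<lambda>t. fst v t - fst x t, \<lambda>t. snd v t - snd x t) < d \<Longrightarrow> \<bar>H v - H x\<bar> < e"
    using H x unfolding compact_functional_def by blast
  have "\<forall>\<^sub>F n in sequentially. normY (\<lambda>t. fst (X n) t - fst x t, \<lambda>t. snd (X n) t - snd x t) < d"
    using order_tendstoD(2)[OF lim d(1)] .
  then show "\<exists>N. \<forall>n\<ge>N. norm (H (X n) - H x) < e"
    using d(2)[OF X] by (auto simp: eventually_sequentially)
qed

text \<open>\<open>Q\<close> is a parameter because the cone couples both indices, whereas
  \<open>a\<close>, \<open>b\<close>, \<open>c\<close> here belong to one equation. Both instances
  share the same \<open>Q\<close>.\<close>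

locale hammerstein_component = hammerstein_kernel +
  fixes \<psi>0 \<psi>1 :: "real \<Rightarrow> real" and c0 c1 R :: real
    and H G :: "(real \<Rightarrow> real) \<times> (real \<Rightarrow> real) \<Rightarrow> real" and Q :: "((real \<Rightarrow> real) \<times> (real \<Rightarrow> real)) set"
  assumes \<psi>0: "continuous_on {0..1} \<psi>0" "\<And>t. t \<in> {0..1} \<Longrightarrow> 0 \<le> \<psi>0 t" "0 < c0"
      "\<And>t. t \<in> {a..b} \<Longrightarrow> c0 * sup_norm \<psi>0 \<le> \<psi>0 t"
    and \<psi>1: "continuous_on {0..1} \<psi>1" "\<And>t. t \<in> {0..1} \<Longrightarrow> 0 \<le> \<psi>1 t" "0 < c1"
      "\<And>t. t \<in> {a..b} \<Longrightarrow> c1 * sup_norm \<psi>1 \<le> \<psi>1 t"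
    and H: "compact_functional Q H" "\<And>u. u \<in> Q \<Longrightarrow> 0 \<le> H u"
    and G: "compact_functional Q G" "\<And>u. u \<in> Q \<Longrightarrow> 0 \<le> G u"
    and Q: "\<And>u. u \<in> Q \<Longrightarrow> continuous_on {0..1} (fst u) \<and> continuous_on {0..1} (snd u) \<and>
        (\<forall>t\<in>{0..1}. 0 \<le> fst u t \<and> 0 \<le> snd u t)"
    and R: "0 < R"
begin

definition S :: "(real \<Rightarrow> real) \<times> (real \<Rightarrow> real) \<Rightarrow> real \<Rightarrow> real" where
  "S u t = \<psi>0 t * H u + \<psi>1 t * G u + integral_op (fst u) (snd u) t"

definition sphere :: "((real \<Rightarrow> real) \<times> (real \<Rightarrow> real)) set" where
  "sphere = {u \<in> Q. normY u = R}"

section \<open>Uniform estimates on the sphere\<close>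

lemma sphere_nonneg_below:
  assumes "u \<in> sphere"
  shows "nonneg_below R (fst u)" "nonneg_below R (snd u)"
proof -
  have uQ: "u \<in> Q" and n: "normY u = R" using assms by (auto simp: sphere_def)
  note q = Q[OF uQ]
  have "fst u t \<le> R" "snd u t \<le> R" if "t \<in> {0..1}" for t
    using abs_le_sup_norm[of "fst u" t] abs_le_sup_norm[of "snd u" t] sup_norm_le_normY[of u] q that n
    by fastforce+
  with q show "nonneg_below R (fst u)" "nonneg_below R (snd u)" by (auto simp: nonneg_below_def)
qed

lemma functional_bounded:
  assumes "compact_functional Q J"
  shows "\<exists>M\<ge>0. \<forall>u\<in>sphere. \<bar>J u\<bar> \<le> M"
proof -
  have "bounded (J ` sphere)"
    using assms unfolding compact_functional_def sphere_def by (metis (mono_tags, lifting) mem_Collect_eq order_refl subsetI)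
  then obtain M where "\<And>u. u \<in> sphere \<Longrightarrow> \<bar>J u\<bar> \<le> M" by (auto simp: bounded_iff)
  then have "\<forall>u\<in>sphere. \<bar>J u\<bar> \<le> max 0 M" by (simp add: le_max_iff_disj)
  then show ?thesis by (intro exI[of _ "max 0 M"]) auto
qed

lemma S_nonneg: "u \<in> sphere \<Longrightarrow> t \<in> {0..1} \<Longrightarrow> 0 \<le> S u t"
  unfolding S_def using \<psi>0(2) \<psi>1(2) H(2) G(2) integral_op_nonneg[OF sphere_nonneg_below]
  by (auto simp: sphere_def intro!: add_nonneg_nonneg mult_nonneg_nonneg)

text \<open>\<open>H\<close> and \<open>G\<close> are bounded on the sphere, so the oscillation of
  \<open>\<psi>0\<close>, of \<open>\<psi>1\<close> and of the kernel in L^1 gives one modulus valid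
  for all \<open>u\<close> there.\<close>

lemma S_modulus:
  assumes t: "t \<in> {0..1}"
  shows "\<exists>\<omega>. (\<omega> \<longlongrightarrow> 0) (at t within {0..1}) \<and> (\<forall>u\<in>sphere. \<forall>t'\<in>{0..1}. \<bar>S u t' - S u t\<bar> \<le> \<omega> t')"
proof -
  obtain MH where MH: "\<And>u. u \<in> sphere \<Longrightarrow> \<bar>H u\<bar> \<le> MH" using functional_bounded[OF H(1)] by blast
  obtain MG where MG: "\<And>u. u \<in> sphere \<Longrightarrow> \<bar>G u\<bar> \<le> MG" using functional_bounded[OF G(1)] by blast
  obtain M where M: "\<And>u v t t'. nonneg_below R u \<Longrightarrow> nonneg_below R v \<Longrightarrow> t \<in> {0..1} \<Longrightarrow> t' \<in> {0..1} \<Longrightarrow>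
      \<bar>integral_op u v t' - integral_op u v t\<bar> \<le> M * (\<integral>s. \<bar>k t' s - k t s\<bar> \<partial>L01)"
    using integral_op_equicont[OF R] by metis
  define \<omega> where "\<omega> = (\<lambda>t'. \<bar>\<psi>0 t' - \<psi>0 t\<bar> * MH + \<bar>\<psi>1 t' - \<psi>1 t\<bar> * MG + M * (\<integral>s. \<bar>k t' s - k t s\<bar> \<partial>L01))"
  have psi_lim: "((\<lambda>t'. \<bar>\<psi> t' - \<psi> t\<bar>) \<longlongrightarrow> 0) (at t within {0..1})"
    if "continuous_on {0..1} \<psi>" for \<psi> :: "real \<Rightarrow> real"
    using that t by (simp add: continuous_on_def tendsto_rabs_zero_iff LIM_zero_iff)
  have "(\<omega> \<longlongrightarrow> 0 * MH + 0 * MG + M * 0) (at t within {0..1})"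
    unfolding \<omega>_def by (intro tendsto_intros psi_lim \<psi>0(1) \<psi>1(1) k_L1_continuous t)
  moreover have "\<bar>S u t' - S u t\<bar> \<le> \<omega> t'" if u: "u \<in> sphere" and t': "t' \<in> {0..1}" for u t'
  proof -
    have "S u t' - S u t = (\<psi>0 t' - \<psi>0 t) * H u + (\<psi>1 t' - \<psi>1 t) * G u +
        (integral_op (fst u) (snd u) t' - integral_op (fst u) (snd u) t)"
      by (simp add: S_def algebra_simps)
    moreover have "\<bar>(\<psi>0 t' - \<psi>0 t) * H u\<bar> \<le> \<bar>\<psi>0 t' - \<psi>0 t\<bar> * MH"
      using MH[OF u] by (simp add: abs_mult mult_left_mono)
    moreover have "\<bar>(\<psi>1 t' - \<psi>1 t) * G u\<bar> \<le> \<bar>\<psi>1 t' - \<psi>1 t\<bar> * MG"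
      using MG[OF u] by (simp add: abs_mult mult_left_mono)
    moreover note M[OF sphere_nonneg_below[OF u] t t']
    ultimately show ?thesis unfolding \<omega>_def by linarith
  qed
  ultimately show ?thesis by (intro exI[of _ \<omega>]) auto
qed

lemma S_equicontinuous:
  assumes t: "t \<in> {0..1}" and e: "0 < e"
  shows "\<exists>d>0. \<forall>u\<in>sphere. \<forall>t'\<in>{0..1}. \<bar>t' - t\<bar> < d \<longrightarrow> \<bar>S u t' - S u t\<bar> < e"
proof -
  obtain \<omega> where \<omega>: "(\<omega> \<longlongrightarrow> 0) (at t within {0..1})"
      "\<And>u t'. u \<in> sphere \<Longrightarrow> t' \<in> {0..1} \<Longrightarrow> \<bar>S u t' - S u t\<bar> \<le> \<omega> t'"
    using S_modulus[OF t] by blast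
  have "\<forall>\<^sub>F t' in at t within {0..1}. \<omega> t' < e" using order_tendstoD(2)[OF \<omega>(1) e] .
  then obtain d where d: "d > 0" "\<And>t'. t' \<in> {0..1} \<Longrightarrow> t' \<noteq> t \<Longrightarrow> dist t' t < d \<Longrightarrow> \<omega> t' < e"
    unfolding eventually_at by auto
  have "\<bar>S u t' - S u t\<bar> < e" if "u \<in> sphere" "t' \<in> {0..1}" "\<bar>t' - t\<bar> < d" for u t'
  proof (cases "t' = t")
    case False
    then show ?thesis using \<omega>(2)[OF that(1,2)] d(2)[OF that(2)] that(3) by (simp add: dist_real_def)
  qed (simp add: e)
  with d(1) show ?thesis by blast
qed

lemma S_continuous:
  assumes u: "u \<in> sphere"
  shows "continuous_on {0..1} (S u)"
  unfolding continuous_on_iff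
proof (intro ballI allI impI)
  fix t e :: real assume t: "t \<in> {0..1}" "0 < e"
  from S_equicontinuous[OF this] u
  show "\<exists>d>0. \<forall>t'\<in>{0..1}. dist t' t < d \<longrightarrow> dist (S u t') (S u t) < e"
    unfolding dist_real_def by blast
qed

text \<open>Each of the three summands satisfies its own Harnack-type inequality, and the smallest
  constant serves for all of them. They are compared pointwise, as
  \<open>m * S u t' \<le> S u t\<close>, before the supremum over \<open>t'\<close> is taken: the
  summands may attain their maxima at different points.\<close>

lemma S_cone:
  assumes u: "u \<in> sphere"
  shows "S u \<in> cone_Qi (min c (min c0 c1)) a b"
  unfolding cone_Qi_iff[OF ab]
proof (intro conjI ballI)
  define m where "m = min c (min c0 c1)"
  have m: "0 < m" "m \<le> c" "m \<le> c0" "m \<le> c1" using c \<psi>0(3) \<psi>1(3) by (auto simp: m_def)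
  show "continuous_on {0..1} (S u)" using u by (rule S_continuous)
  show "0 \<le> S u t" if "t \<in> {0..1}" for t using S_nonneg[OF u that] .
  fix t assume t: "t \<in> {a..b}"
  have uQ: "u \<in> Q" using u by (simp add: sphere_def)
  have "sup_norm (S u) \<le> S u t / m"
  proof (rule sup_norm_le)
    fix t' :: real assume t': "t' \<in> {0..1}"
    have p: "m * \<psi> t' \<le> \<psi> t"
      if "continuous_on {0..1} \<psi>" "0 \<le> \<psi> t'" "m \<le> cj" "cj * sup_norm \<psi> \<le> \<psi> t" for \<psi> cj
    proof -
      have "\<psi> t' \<le> sup_norm \<psi>" using abs_le_sup_norm[OF that(1) t'] that(2) by simp
      then have "m * \<psi> t' \<le> cj * sup_norm \<psi>" using that m by (intro mult_mono) auto
      then show ?thesis using that(4) by simp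
    qed
    have "m * \<psi>0 t' \<le> \<psi>0 t" using p \<psi>0 m t t' by blast
    then have 1: "m * \<psi>0 t' * H u \<le> \<psi>0 t * H u" using H(2)[OF uQ] by (rule mult_right_mono)
    have "m * \<psi>1 t' \<le> \<psi>1 t" using p \<psi>1 m t t' by blast
    then have 2: "m * \<psi>1 t' * G u \<le> \<psi>1 t * G u" using G(2)[OF uQ] by (rule mult_right_mono)
    have "m * integral_op (fst u) (snd u) t' \<le> c * integral_op (fst u) (snd u) t'"
      using m integral_op_nonneg[OF sphere_nonneg_below[OF u] t'] by (intro mult_right_mono)
    also have "\<dots> \<le> integral_op (fst u) (snd u) t"
      by (rule integral_op_lower[OF R sphere_nonneg_below[OF u] t t'])
    finally have 3: "m * integral_op (fst u) (snd u) t' \<le> integral_op (fst u) (snd u) t" .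
    have "m * S u t' \<le> S u t" using 1 2 3 by (simp add: S_def algebra_simps)
    then show "\<bar>S u t'\<bar> \<le> S u t / m" using S_nonneg[OF u t'] m by (simp add: field_simps)
  qed
  then show "min c (min c0 c1) * sup_norm (S u) \<le> S u t"
    using m(1) by (simp add: m_def[symmetric] field_simps)
qed

lemma S_bounded: "\<exists>M. \<forall>u\<in>sphere. \<forall>t\<in>{0..1}. \<bar>S u t\<bar> \<le> M"
proof -
  obtain MH where MH: "\<And>u. u \<in> sphere \<Longrightarrow> \<bar>H u\<bar> \<le> MH" using functional_bounded[OF H(1)] by blast
  obtain MG where MG: "\<And>u. u \<in> sphere \<Longrightarrow> \<bar>G u\<bar> \<le> MG" using functional_bounded[OF G(1)] by blast
  obtain M where M: "\<And>u v t. nonneg_below R u \<Longrightarrow> nonneg_below R v \<Longrightarrow> t \<in> {0..1} \<Longrightarrow> integral_op u v t \<le> M"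
    using integral_op_bounded[OF R] by blast
  have "\<bar>S u t\<bar> \<le> sup_norm \<psi>0 * MH + sup_norm \<psi>1 * MG + M" if u: "u \<in> sphere" and t: "t \<in> {0..1}" for u t
  proof -
    have "\<bar>\<psi>0 t * H u\<bar> \<le> sup_norm \<psi>0 * MH" "\<bar>\<psi>1 t * G u\<bar> \<le> sup_norm \<psi>1 * MG"
      unfolding abs_mult using MH[OF u] MG[OF u] abs_le_sup_norm[OF \<psi>0(1) t] abs_le_sup_norm[OF \<psi>1(1) t]
      by (auto intro!: mult_mono sup_norm_nonneg \<psi>0(1) \<psi>1(1))
    then show ?thesis
      using S_nonneg[OF u t] M[OF sphere_nonneg_below[OF u] t] by (simp add: S_def)
  qed
  then show ?thesis by blast
qed

lemma S_compact: "compact (closure (bc01 ` S ` sphere))"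
proof -
  obtain M where M: "\<And>u t. u \<in> sphere \<Longrightarrow> t \<in> {0..1} \<Longrightarrow> \<bar>S u t\<bar> \<le> M" using S_bounded by blast
  show ?thesis
  proof (rule compact_closure_bc01)
    show "\<bar>x t\<bar> \<le> M" if "x \<in> S ` sphere" "t \<in> {0..1}" for x t using that M by blast
    show "continuous_on {0..1} x" if "x \<in> S ` sphere" for x using that S_continuous by blast
    show "\<exists>d>0. \<forall>x\<in>S ` sphere. \<forall>t'\<in>{0..1}. \<bar>t' - t\<bar> < d \<longrightarrow> \<bar>x t' - x t\<bar> < e"
      if "t \<in> {0..1}" "0 < e" for t e
      using S_equicontinuous[OF that] by blast
  qed
qed

lemma S_tendsto:
  assumes X: "\<And>n. X n \<in> sphere" and x: "x \<in> sphere"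
    and lim: "(\<lambda>n. normY (\<lambda>t. fst (X n) t - fst x t, \<lambda>t. snd (X n) t - snd x t)) \<longlonglongrightarrow> 0"
  shows "(\<lambda>n. bc01 (S (X n))) \<longlonglongrightarrow> bc01 (S x)"
proof -
  define d where "d = (\<lambda>n. normY (\<lambda>t. fst (X n) t - fst x t, \<lambda>t. snd (X n) t - snd x t))"
  have XQ: "X n \<in> Q" for n using X by (simp add: sphere_def)
  have xQ: "x \<in> Q" using x by (simp add: sphere_def)
  have "\<bar>fst (X n) t - fst x t\<bar> \<le> d n" "\<bar>snd (X n) t - snd x t\<bar> \<le> d n" if "t \<in> {0..1}" for n t
    using abs_le_sup_norm[of "\<lambda>t. fst (X n) t - fst x t" t] abs_le_sup_norm[of "\<lambda>t. snd (X n) t - snd x t" t]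
      Q[OF XQ[of n]] Q[OF xQ] that by (auto simp: d_def normY_def continuous_on_diff le_max_iff_disj)
  then have "(\<lambda>n. fst (X n) t - fst x t) \<longlonglongrightarrow> 0" "(\<lambda>n. snd (X n) t - snd x t) \<longlonglongrightarrow> 0" if "t \<in> {0..1}" for t
    using that lim[folded d_def] by (auto intro!: Lim_null_comparison[of _ d] always_eventually)
  then have pw: "(\<lambda>n. fst (X n) t) \<longlonglongrightarrow> fst x t" "(\<lambda>n. snd (X n) t) \<longlonglongrightarrow> snd x t" if "t \<in> {0..1}" for t
    using that by (auto simp: LIM_zero_iff)
  obtain \<delta> where \<delta>: "\<delta> \<longlonglongrightarrow> 0" "\<And>n t. t \<in> {0..1} \<Longrightarrow>
      \<bar>integral_op (fst (X n)) (snd (X n)) t - integral_op (fst x) (snd x) t\<bar> \<le> \<delta> n"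
    using integral_op_converges[OF R sphere_nonneg_below(1)[OF X] sphere_nonneg_below(2)[OF X] sphere_nonneg_below[OF x] pw] by blast
  have hg: "(\<lambda>n. \<bar>J (X n) - J x\<bar>) \<longlonglongrightarrow> 0" if "compact_functional Q J" for J
    using compact_functional_tendsto[OF that XQ xQ lim] by (simp add: tendsto_rabs_zero_iff LIM_zero_iff)
  show ?thesis
  proof (rule bc01_tendsto)
    have "(\<lambda>n. sup_norm \<psi>0 * \<bar>H (X n) - H x\<bar> + sup_norm \<psi>1 * \<bar>G (X n) - G x\<bar> + \<delta> n) \<longlonglongrightarrow>
        sup_norm \<psi>0 * 0 + sup_norm \<psi>1 * 0 + 0"
      by (intro tendsto_intros hg H(1) G(1) \<delta>(1))
    then show "(\<lambda>n. sup_norm \<psi>0 * \<bar>H (X n) - H x\<bar> + sup_norm \<psi>1 * \<bar>G (X n) - G x\<bar> + \<delta> n) \<longlonglongrightarrow> 0"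
      by simp
    fix n and t :: real assume t: "t \<in> {0..1}"
    have tri: "\<bar>p + q + r\<bar> \<le> A + B + C" if "\<bar>p\<bar> \<le> A" "\<bar>q\<bar> \<le> B" "\<bar>r\<bar> \<le> C" for p q r A B C :: real
      using that by linarith
    have eq: "S (X n) t - S x t = \<psi>0 t * (H (X n) - H x) + \<psi>1 t * (G (X n) - G x) +
        (integral_op (fst (X n)) (snd (X n)) t - integral_op (fst x) (snd x) t)"
      by (simp add: S_def algebra_simps)
    have 1: "\<bar>\<psi>0 t * (H (X n) - H x)\<bar> \<le> sup_norm \<psi>0 * \<bar>H (X n) - H x\<bar>"
      using abs_le_sup_norm[OF \<psi>0(1) t] by (simp add: abs_mult mult_right_mono)
    have 2: "\<bar>\<psi>1 t * (G (X n) - G x)\<bar> \<le> sup_norm \<psi>1 * \<bar>G (X n) - G x\<bar>"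
      using abs_le_sup_norm[OF \<psi>1(1) t] by (simp add: abs_mult mult_right_mono)
    show "\<bar>S (X n) t - S x t\<bar> \<le>
        sup_norm \<psi>0 * \<bar>H (X n) - H x\<bar> + sup_norm \<psi>1 * \<bar>G (X n) - G x\<bar> + \<delta> n"
      unfolding eq by (rule tri[OF 1 2 \<delta>(2)[OF t]])
  qed (use S_continuous X x in auto)
qed

text \<open>Every value of the bracket is at most \<open>S u t\<close>, hence at most the norm.
  Passing to the supremum needs only a nonempty interval; boundedness of the bracket comes along
  with the estimate.\<close>

lemma S_lower:
  assumes u: "u \<in> sphere" and "\<zeta>H \<le> H u" "\<zeta>G \<le> G u"
    and "\<And>s. s \<in> {a..b} \<Longrightarrow> \<gamma> s \<le> f s (fst u s) (snd u s)"
  shows "(SUP t\<in>{a..b}. \<psi>0 t * \<zeta>H + \<psi>1 t * \<zeta>G + integral\<^sup>L (lebesgue_on {a..b}) (\<lambda>s. k t s * \<gamma> s))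
    \<le> sup_norm (S u)"
proof (rule cSUP_least)
  show "{a..b} \<noteq> {}" using ab by simp
  fix t assume "t \<in> {a..b}"
  then have t: "t \<in> {0..1}" using ab by auto
  have "\<psi>0 t * \<zeta>H + \<psi>1 t * \<zeta>G + integral\<^sup>L (lebesgue_on {a..b}) (\<lambda>s. k t s * \<gamma> s) \<le> S u t"
    unfolding S_def using assms \<psi>0(2)[OF t] \<psi>1(2)[OF t]
    by (intro add_mono mult_left_mono integral_op_ge[OF R sphere_nonneg_below[OF u] t]) auto
  also have "\<dots> \<le> sup_norm (S u)" using abs_le_sup_norm[OF S_continuous[OF u] t] by simp
  finally show "\<psi>0 t * \<zeta>H + \<psi>1 t * \<zeta>G + integral\<^sup>L (lebesgue_on {a..b}) (\<lambda>s. k t s * \<gamma> s) \<le> sup_norm (S u)" .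
qed

end


section \<open>The eigenvalue theorem\<close>

definition fun_pair :: "(real \<Rightarrow>\<^sub>C real) \<times> (real \<Rightarrow>\<^sub>C real) \<Rightarrow> (real \<Rightarrow> real) \<times> (real \<Rightarrow> real)" where
  "fun_pair u = (apply_bcontfun (fst u), apply_bcontfun (snd u))"

text \<open>Only an inequality, since \<open>dist\<close> also sees values outside [0,1]; it is the
  direction that turns convergence in the model into convergence for \<open>normY\<close>.\<close>

lemma normY_diff_fun_pair_le:
  "normY (\<lambda>t. fst (fun_pair u) t - fst (fun_pair v) t, \<lambda>t. snd (fun_pair u) t - snd (fun_pair v) t) \<le> dist u v"
proof -
  have "\<bar>fst (fun_pair u) t - fst (fun_pair v) t\<bar> \<le> dist u v" for t
    using dist_bounded[of "fst u" t "fst v"] dist_fst_le[of u v] by (simp add: fun_pair_def dist_real_def)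
  moreover have "\<bar>snd (fun_pair u) t - snd (fun_pair v) t\<bar> \<le> dist u v" for t
    using dist_bounded[of "snd u" t "snd v"] dist_snd_le[of u v] by (simp add: fun_pair_def dist_real_def)
  ultimately show ?thesis by (simp add: normY_def sup_norm_le)
qed

theorem theorem2p2:
  fixes F :: "nat \<Rightarrow> real \<Rightarrow> real \<Rightarrow> real \<Rightarrow> real"
    and K :: "nat \<Rightarrow> real \<Rightarrow> real \<Rightarrow> real"
    and a b c :: "nat \<Rightarrow> real"
    and \<Phi> :: "nat \<Rightarrow> real \<Rightarrow> real"
    and \<psi> :: "nat \<Rightarrow> nat \<Rightarrow> real \<Rightarrow> real"
    and cc :: "nat \<Rightarrow> nat \<Rightarrow> real"
    and H G :: "nat \<Rightarrow> (real \<Rightarrow> real) \<times> (real \<Rightarrow> real) \<Rightarrow> real"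
    and R :: real
    and \<gamma> :: "nat \<Rightarrow> real \<Rightarrow> real"
    and \<zeta>H \<zeta>G :: "nat \<Rightarrow> real"
  assumes D1_nonneg: "\<And>i t x y. i \<in> {1,2} \<Longrightarrow> t \<in> {0..1} \<Longrightarrow> 0 \<le> x \<Longrightarrow> 0 \<le> y \<Longrightarrow> 0 \<le> F i t x y"
    and D1_meas: "\<And>i x y. i \<in> {1,2} \<Longrightarrow> 0 \<le> x \<Longrightarrow> 0 \<le> y \<Longrightarrow>
        (\<lambda>t. F i t x y) \<in> borel_measurable (lebesgue_on {0..1})"
    and D1_cont: "\<And>i. i \<in> {1,2} \<Longrightarrow>
        AE t in lebesgue_on {0..1}. continuous_on ({0..} \<times> {0..}) (\<lambda>p. F i t (fst p) (snd p))"
    and D1_bound: "\<And>i r. i \<in> {1,2} \<Longrightarrow> r > 0 \<Longrightarrow> \<exists>\<phi>\<in>Linf.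
        AE t in lebesgue_on {0..1}. \<forall>x\<in>{0<..<r}. \<forall>y\<in>{0<..<r}. F i t x y \<le> \<phi> t"
    and D2_nonneg: "\<And>i t s. i \<in> {1,2} \<Longrightarrow> t \<in> {0..1} \<Longrightarrow> s \<in> {0..1} \<Longrightarrow> 0 \<le> K i t s"
    and D2_meas: "\<And>i. i \<in> {1,2} \<Longrightarrow>
        (\<lambda>p. K i (fst p) (snd p)) \<in> borel_measurable (lebesgue_on ({0..1} \<times> {0..1}))"
    and D2_cont: "\<And>i tb s. i \<in> {1,2} \<Longrightarrow> tb \<in> {0..1} \<Longrightarrow> s \<in> {0..1} \<Longrightarrow>
        ((\<lambda>t. \<bar>K i t s - K i tb s\<bar>) \<longlongrightarrow> 0) (at tb within {0..1})"
    and D3_ab: "\<And>i. i \<in> {1,2} \<Longrightarrow> 0 \<le> a i \<and> a i \<le> b i \<and> b i \<le> 1"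
    and D3_Phi: "\<And>i. i \<in> {1,2} \<Longrightarrow> \<Phi> i \<in> Linf"
    and D3_c: "\<And>i. i \<in> {1,2} \<Longrightarrow> c i \<in> {0<..1}"
    and D3_upper: "\<And>i t. i \<in> {1,2} \<Longrightarrow> t \<in> {0..1} \<Longrightarrow>
        AE s in lebesgue_on {0..1}. K i t s \<le> \<Phi> i s"
    and D3_lower: "\<And>i t. i \<in> {1,2} \<Longrightarrow> t \<in> {a i..b i} \<Longrightarrow>
        AE s in lebesgue_on {0..1}. c i * \<Phi> i s \<le> K i t s"
    and D4_cont: "\<And>i j. i \<in> {1,2} \<Longrightarrow> j \<in> {0,1} \<Longrightarrow> continuous_on {0..1} (\<psi> i j)"
    and D4_nonneg: "\<And>i j t. i \<in> {1,2} \<Longrightarrow> j \<in> {0,1} \<Longrightarrow> t \<in> {0..1} \<Longrightarrow> 0 \<le> \<psi> i j t"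
    and D4_cc: "\<And>i j. i \<in> {1,2} \<Longrightarrow> j \<in> {0,1} \<Longrightarrow> cc i j \<in> {0<..1}"
    and D4_lower: "\<And>i j t. i \<in> {1,2} \<Longrightarrow> j \<in> {0,1} \<Longrightarrow> t \<in> {a i..b i} \<Longrightarrow>
        cc i j * sup_norm (\<psi> i j) \<le> \<psi> i j t"
    and D5_H: "\<And>i. i \<in> {1,2} \<Longrightarrow> compact_functional (coneQ c cc a b) (H i) \<and>
        (\<forall>u\<in>coneQ c cc a b. 0 \<le> H i u)"
    and D5_G: "\<And>i. i \<in> {1,2} \<Longrightarrow> compact_functional (coneQ c cc a b) (G i) \<and>
        (\<forall>u\<in>coneQ c cc a b. 0 \<le> G i u)"
    and R_pos: "0 < R"
    and h1_cont: "\<And>i. i \<in> {1,2} \<Longrightarrow> continuous_on {0..1} (\<gamma> i) \<and> (\<forall>t\<in>{0..1}. 0 \<le> \<gamma> i t)"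
    and h1: "\<And>i t x y. i \<in> {1,2} \<Longrightarrow> t \<in> {a i..b i} \<Longrightarrow>
        x \<in> {(if i = 1 then ctil c cc i * R else 0)..R} \<Longrightarrow>
        y \<in> {(if i = 2 then ctil c cc i * R else 0)..R} \<Longrightarrow> \<gamma> i t \<le> F i t x y"
    and h2: "\<And>i. i \<in> {1,2} \<Longrightarrow> 0 \<le> \<zeta>H i \<and> 0 \<le> \<zeta>G i \<and>
        (\<forall>u\<in>coneQ c cc a b. normY u = R \<longrightarrow> \<zeta>H i \<le> H i u \<and> \<zeta>G i \<le> G i u)"
    and h3: "\<And>i. i \<in> {1,2} \<Longrightarrow>
        (SUP t\<in>{a i..b i}. \<psi> i 0 t * \<zeta>H i + \<psi> i 1 t * \<zeta>G i +
           integral\<^sup>L (lebesgue_on {a i..b i}) (\<lambda>s. K i t s * \<gamma> i s)) > 0"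
  shows "\<exists>lam>0. \<exists>u\<in>coneQ c cc a b. normY u = R \<and>
           (\<forall>t\<in>{0..1}. fst u t = lam * Sop \<psi> H G K F 1 u t \<and>
                         snd u t = lam * Sop \<psi> H G K F 2 u t)"
proof -
  note One_nat_def[simp del]
  let ?Q = "coneQ c cc a b"
  have ab: "0 \<le> a i" "a i \<le> b i" "b i \<le> 1" if "i \<in> {1,2}" for i using D3_ab[OF that] by auto
  have ctil_pos: "0 < ctil c cc i" and ctil_le: "ctil c cc i \<le> 1" if "i \<in> {1,2}" for i
    using D3_c[OF that] D4_cc[OF that, of 0] D4_cc[OF that, of 1] by (auto simp: ctil_def)
  note cone_iff1 = cone_Qi_iff[OF ab[of 1, simplified]]
  note cone_iff2 = cone_Qi_iff[OF ab[of 2, simplified]]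
  have Q_fun: "continuous_on {0..1} (fst u) \<and> continuous_on {0..1} (snd u) \<and>
        (\<forall>t\<in>{0..1}. 0 \<le> fst u t \<and> 0 \<le> snd u t)" if "u \<in> ?Q" for u
    using that by (auto simp: coneQ_def cone_iff1 cone_iff2)
  have comp: "hammerstein_component (K i) (F i) (\<Phi> i) (a i) (b i) (c i) (\<psi> i 0) (\<psi> i 1)
      (cc i 0) (cc i 1) R (H i) (G i) ?Q" if i: "i \<in> {1,2}" for i
  proof -
    have j: "0 \<in> {0, 1::nat}" "1 \<in> {0, 1::nat}" by auto
    have pos: "0 < c i" "0 < cc i 0" "0 < cc i 1"
      using D3_c[OF i] D4_cc[OF i j(1)] D4_cc[OF i j(2)] by auto
    have HG: "compact_functional ?Q (H i)" "\<And>u. u \<in> ?Q \<Longrightarrow> 0 \<le> H i u"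
        "compact_functional ?Q (G i)" "\<And>u. u \<in> ?Q \<Longrightarrow> 0 \<le> G i u"
      using D5_H[OF i] D5_G[OF i] by auto
    show ?thesis
      by (intro hammerstein_component.intro hammerstein_kernel.intro hammerstein_component_axioms.intro;
          fact ab[OF i] D1_nonneg[OF i] D1_meas[OF i] D1_cont[OF i] D1_bound[OF i] D2_nonneg[OF i]
            D2_meas[OF i] D2_cont[OF i] D3_Phi[OF i] D3_upper[OF i] D3_lower[OF i]
            D4_cont[OF i j(1)] D4_cont[OF i j(2)] D4_nonneg[OF i j(1)] D4_nonneg[OF i j(2)]
            D4_lower[OF i j(1)] D4_lower[OF i j(2)] pos HG R_pos Q_fun)
  qed
  interpret S1: hammerstein_component "K 1" "F 1" "\<Phi> 1" "a 1" "b 1" "c 1" "\<psi> 1 0" "\<psi> 1 1"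
    "cc 1 0" "cc 1 1" R "H 1" "G 1" ?Q by (rule comp) simp
  interpret S2: hammerstein_component "K 2" "F 2" "\<Phi> 2" "a 2" "b 2" "c 2" "\<psi> 2 0" "\<psi> 2 1"
    "cc 2 0" "cc 2 1" R "H 2" "G 2" ?Q by (rule comp) simp
  have Sop1: "Sop \<psi> H G K F 1 u = S1.S u" for u
    by (rule ext) (simp add: Sop_def S1.S_def S1.integral_op_def)
  have Sop2: "Sop \<psi> H G K F 2 u = S2.S u" for u
    by (rule ext) (simp add: Sop_def S2.S_def S2.integral_op_def)
  define QQ where "QQ = {u. fun_pair u \<in> ?Q}"
  define p where "p = (\<lambda>u. normY (fun_pair u))"
  define SS where "SS = (\<lambda>u. (bc01 (S1.S (fun_pair u)), bc01 (S2.S (fun_pair u))))"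
  define C where "C = closure (bc01 ` S1.S ` S1.sphere) \<times> closure (bc01 ` S2.S ` S2.sphere)"
  define Q1 where "Q1 = {x. apply_bcontfun x \<in> cone_Qi (ctil c cc 1) (a 1) (b 1)}"
  define Q2 where "Q2 = {x. apply_bcontfun x \<in> cone_Qi (ctil c cc 2) (a 2) (b 2)}"
  \<comment> \<open>The supremum in condition (3). On the sphere either component may be the one of
    norm \<open>R\<close>, so the uniform lower bound is the smaller of \<open>m 1\<close> and
    \<open>m 2\<close>.\<close>
  define m where "m = (\<lambda>i. SUP t\<in>{a i..b i}. \<psi> i 0 t * \<zeta>H i + \<psi> i 1 t * \<zeta>G i +
           integral\<^sup>L (lebesgue_on {a i..b i}) (\<lambda>s. K i t s * \<gamma> i s))"
  have QQ: "QQ = Q1 \<times> Q2" by (auto simp: QQ_def Q1_def Q2_def coneQ_def fun_pair_def)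
  have in_sphere: "fun_pair u \<in> S1.sphere" "fun_pair u \<in> S2.sphere" if "u \<in> QQ" "p u = R" for u
    using that by (auto simp: S1.sphere_def S2.sphere_def QQ_def p_def)
  have bc_cone: "bc01 x \<in> {x. apply_bcontfun x \<in> cone_Qi (ctil c cc i) (a i) (b i)}"
    if i: "i \<in> {1,2}" and x: "x \<in> cone_Qi (ctil c cc i) (a i) (b i)" for i x
  proof -
    have "continuous_on {0..1} x" using x by (simp add: cone_Qi_iff[OF ab[OF i]])
    then have "apply_bcontfun (bc01 x) \<in> cone_Qi (ctil c cc i) (a i) (b i) \<longleftrightarrow>
        x \<in> cone_Qi (ctil c cc i) (a i) (b i)"
      by (intro cone_Qi_cong[OF ab[OF i]]) simp
    with x show ?thesis by simp
  qed
  have "\<exists>x\<in>QQ. p x = R \<and> (\<exists>l>0. x = l *\<^sub>R SS x)"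
  proof (rule birkhoff_kellogg_cone)
    show "x + y \<in> QQ" if "x \<in> QQ" "y \<in> QQ" for x y
      using that ctil_pos[of 1] ctil_pos[of 2] ab[of 1] ab[of 2]
      by (auto simp: QQ_def coneQ_def fun_pair_def plus_bcontfun.rep_eq intro!: cone_Qi_add)
    show "r *\<^sub>R x \<in> QQ" if "x \<in> QQ" "0 \<le> r" for r x
      using that ab[of 1] ab[of 2]
      by (auto simp: QQ_def coneQ_def fun_pair_def scaleR_bcontfun.rep_eq intro!: cone_Qi_scale)
    show "continuous_on QQ p"
      unfolding p_def normY_def fun_pair_def fst_conv snd_conv
      by (intro continuous_on_max continuous_on_compose2[OF continuous_on_bcontfun_sup_norm[of UNIV]]
          continuous_intros) auto
    show "p (r *\<^sub>R x) = r * p x" if "x \<in> QQ" "0 \<le> r" for r x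
      using that by (simp add: p_def normY_def fun_pair_def scaleR_bcontfun.rep_eq sup_norm_scale max_mult_distrib_left)
    show "p (x + y) \<le> p x + p y" for x y
    proof -
      have *: "sup_norm (apply_bcontfun (v + w)) \<le> sup_norm (apply_bcontfun v) + sup_norm (apply_bcontfun w)"
        for v w :: "real \<Rightarrow>\<^sub>C real"
        unfolding plus_bcontfun.rep_eq by (rule sup_norm_add) auto
      show ?thesis
        using *[of "fst x" "fst y"] *[of "snd x" "snd y"]
        unfolding p_def normY_def fun_pair_def fst_conv snd_conv fst_add snd_add by linarith
    qed
    show "p x \<le> p (x + y)" if "x \<in> QQ" "y \<in> QQ" for x y
    proof -
      have *: "sup_norm (apply_bcontfun v) \<le> sup_norm (apply_bcontfun (v + w))"
        if "\<And>t. t \<in> {0..1} \<Longrightarrow> 0 \<le> v t \<and> 0 \<le> w t" for v w :: "real \<Rightarrow>\<^sub>C real"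
        using that by (intro sup_norm_mono continuous_on_apply_bcontfun) auto
      have "sup_norm (apply_bcontfun (fst x)) \<le> sup_norm (apply_bcontfun (fst x + fst y))"
        "sup_norm (apply_bcontfun (snd x)) \<le> sup_norm (apply_bcontfun (snd x + snd y))"
        by (rule *; use that Q_fun[of "fun_pair x"] Q_fun[of "fun_pair y"] in \<open>auto simp: QQ_def fun_pair_def\<close>)+
      then show ?thesis
        unfolding p_def normY_def fun_pair_def fst_conv snd_conv fst_add snd_add by linarith
    qed
    have one: "sup_norm (\<lambda>t. 1) = 1" by (simp add: sup_norm_def)
    \<comment> \<open>For the constant function 1 the cone inequality reads
      \<open>ctil c cc i \<le> 1\<close>, which holds because all constants involved are at most
      1.\<close>
    show "(const_bcontfun 1, const_bcontfun 1) \<in> QQ"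
      using ctil_le[of 1] ctil_le[of 2]
      by (auto simp: QQ_def coneQ_def fun_pair_def cone_iff1 cone_iff2 const_bcontfun.rep_eq one)
    show "0 < p (const_bcontfun 1, const_bcontfun 1)"
      by (simp add: p_def fun_pair_def normY_def const_bcontfun.rep_eq one)
    show "0 < R" by (rule R_pos)
    show "continuous_on {x \<in> QQ. p x = R} SS"
      unfolding continuous_on_sequentially
    proof (intro allI ballI impI)
      fix X x assume x: "x \<in> {x \<in> QQ. p x = R}" and "(\<forall>n. X n \<in> {x \<in> QQ. p x = R}) \<and> X \<longlonglongrightarrow> x"
      then have X: "\<And>n. X n \<in> {x \<in> QQ. p x = R}" and lim: "X \<longlonglongrightarrow> x" by auto
      have "(\<lambda>n. dist (X n) x) \<longlonglongrightarrow> 0" using lim by (subst (asm) tendsto_dist_iff)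
      then have d: "(\<lambda>n. normY (\<lambda>t. fst (fun_pair (X n)) t - fst (fun_pair x) t, \<lambda>t. snd (fun_pair (X n)) t - snd (fun_pair x) t)) \<longlonglongrightarrow> 0"
      proof (rule Lim_null_comparison[rotated], intro always_eventually allI)
        fix n
        have "0 \<le> normY (\<lambda>t. fst (fun_pair (X n)) t - fst (fun_pair x) t, \<lambda>t. snd (fun_pair (X n)) t - snd (fun_pair x) t)"
          unfolding normY_def by (auto simp: le_max_iff_disj fun_pair_def intro!: sup_norm_nonneg continuous_intros)
        then show "norm (normY (\<lambda>t. fst (fun_pair (X n)) t - fst (fun_pair x) t, \<lambda>t. snd (fun_pair (X n)) t - snd (fun_pair x) t)) \<le> dist (X n) x"
          using normY_diff_fun_pair_le[of "X n" x] by simp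
      qed
      show "(SS \<circ> X) \<longlonglongrightarrow> SS x"
        unfolding SS_def o_def
        using X x by (intro tendsto_Pair S1.S_tendsto S2.S_tendsto d in_sphere) auto
    qed
    show "SS ` {x \<in> QQ. p x = R} \<subseteq> C"
      using in_sphere closure_subset by (fastforce simp: SS_def C_def)
    show "compact C" unfolding C_def by (intro compact_Times S1.S_compact S2.S_compact)
    have "bc01 ` S1.S ` S1.sphere \<subseteq> Q1" "bc01 ` S2.S ` S2.sphere \<subseteq> Q2"
      using S1.S_cone S2.S_cone bc_cone[of 1] bc_cone[of 2] by (auto simp: Q1_def Q2_def ctil_def)
    moreover have "closed Q1" "closed Q2"
      unfolding Q1_def Q2_def using closed_bcontfun_cone_Qi ab by auto
    ultimately show "C \<subseteq> QQ" unfolding C_def QQ by (intro Sigma_mono closure_minimal)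
    show "0 < min (m 1) (m 2)" using h3[of 1] h3[of 2] by (simp add: m_def)
    fix x assume x: "x \<in> QQ" "p x = R"
    define u where "u = fun_pair x"
    have uQ: "u \<in> ?Q" and uR: "normY u = R" using x by (auto simp: u_def QQ_def p_def)
    have u_le: "0 \<le> fst u s" "fst u s \<le> R" "0 \<le> snd u s" "snd u s \<le> R" if "s \<in> {0..1}" for s
      using S1.sphere_nonneg_below[OF in_sphere(1)[OF x]] that by (auto simp: nonneg_below_def u_def)
    have "p (SS x) = max (sup_norm (S1.S u)) (sup_norm (S2.S u))"
      using S1.S_continuous[OF in_sphere(1)[OF x]] S2.S_continuous[OF in_sphere(2)[OF x]]
      by (simp add: p_def SS_def u_def normY_def fun_pair_def sup_norm_bc01)
    moreover have "m 1 \<le> sup_norm (S1.S u) \<or> m 2 \<le> sup_norm (S2.S u)"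
    proof -
      consider "sup_norm (fst u) = R" | "sup_norm (snd u) = R"
        using uR by (auto simp: normY_def max_def split: if_splits)
      then show ?thesis
      proof cases
        case 1
        have "\<gamma> 1 s \<le> F 1 s (fst u s) (snd u s)" if s: "s \<in> {a 1..b 1}" for s
        proof -
          have s01: "s \<in> {0..1}" using s ab[of 1] by auto
          have "ctil c cc 1 * R \<le> fst u s" using uQ 1 s by (auto simp: coneQ_def cone_iff1)
          then show ?thesis using h1[of 1 s "fst u s" "snd u s"] s u_le[OF s01] by auto
        qed
        then have "m 1 \<le> sup_norm (S1.S u)"
          unfolding m_def using h2[of 1] uQ uR in_sphere(1)[OF x] by (intro S1.S_lower) (auto simp: u_def)
        then show ?thesis ..
      next
        case 2
        have "\<gamma> 2 s \<le> F 2 s (fst u s) (snd u s)" if s: "s \<in> {a 2..b 2}" for s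
        proof -
          have s01: "s \<in> {0..1}" using s ab[of 2] by auto
          have "ctil c cc 2 * R \<le> snd u s" using uQ 2 s by (auto simp: coneQ_def cone_iff2)
          then show ?thesis using h1[of 2 s "fst u s" "snd u s"] s u_le[OF s01] by auto
        qed
        then have "m 2 \<le> sup_norm (S2.S u)"
          unfolding m_def using h2[of 2] uQ uR in_sphere(2)[OF x] by (intro S2.S_lower) (auto simp: u_def)
        then show ?thesis ..
      qed
    qed
    ultimately show "min (m 1) (m 2) \<le> p (SS x)" by linarith
  qed
  then obtain x l where x: "x \<in> QQ" "p x = R" and l: "0 < l" "x = l *\<^sub>R SS x" by blast
  \<comment> \<open>The continuation \<open>bc01\<close> changes nothing on [0,1], so the vector
    equation in the model is the eigenvalue equation at each \<open>t\<close> there.\<close>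
  have "fst (fun_pair x) t = l * S1.S (fun_pair x) t" "snd (fun_pair x) t = l * S2.S (fun_pair x) t" if t: "t \<in> {0..1}" for t
  proof -
    have "fst (fun_pair x) t = l * apply_bcontfun (fst (SS x)) t" "snd (fun_pair x) t = l * apply_bcontfun (snd (SS x)) t"
      by (subst l(2), simp add: fun_pair_def scaleR_bcontfun.rep_eq)+
    then show "fst (fun_pair x) t = l * S1.S (fun_pair x) t" "snd (fun_pair x) t = l * S2.S (fun_pair x) t"
      using S1.S_continuous[OF in_sphere(1)[OF x]] S2.S_continuous[OF in_sphere(2)[OF x]] t
      by (simp_all add: SS_def)
  qed
  moreover have "fun_pair x \<in> ?Q" "normY (fun_pair x) = R" using x by (auto simp: QQ_def p_def)
  ultimately show ?thesis
    unfolding Sop1 Sop2 using l(1) by blast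
qed

end
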